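(* The category $\mathbf{EDTych}$ of extremally disconnected Tychonoff spaces and continuous maps and the category $\mathbf{zCBoole}$ of complete z-algebras are dually equivalent.
   Context: Boolean algebras with $0=1$ are allowed. $\mathbf{2}=\{0,1\}$ is the two-element Boolean algebra; $\mathbf{Boole}(A,\mathbf 2)$ is the set of Boolean homomorphisms $A\to\mathbf 2$. $\mathbf{EDTych}$ is the category of all extremally disconnected Tychonoff spaces (Tychonoff spaces, Hausdorff included, in which the closure of every open set is open) and all continuous maps. A Boolean z-algebra is a pair $(A,X)$, where $A$ is a Boolean algebra and $X\subseteq\mathbf{Boole}(A,\mathbf 2)$, such that for each $a\in A\setminus\{0\}$ there is $x\in X$ with $x(a)=1$. It is a complete z-algebra if $A$ is a complete Boolean algebra. $\mathbf{zBoole}$ is the category whose objects are all Boolean z-algebras and whose morphisms $(A,X)\to(A',X')$ are all pairs $(\varphi,f)$ with $\varphi:A\to A'$ a Boolean homomorphism (not required to be complete) and $f:X'\to X$ a function such that $x'\circ\varphi=f(x')$ for every $x'\in X'$; composition is $(\varphi',f')\circ(\varphi,f)=(\varphi'\circ\varphi,f\circ f')$ and identities are $(id_A,id_X)$. $\mathbf{zCBoole}$ is the full subcategory of $\mathbf{zBoole}$ whose objects are all complete z-algebras. Two categories are dually equivalent if there are contravariant functors between them in both directions whose two composites are naturally isomorphic to the identity functors. *)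

theory Defs
  imports "HOL-Algebra.Complete_Lattice" "HOL-Analysis.Analysis"
begin

section \<open>Categories, contravariant functors, dual equivalence\<close>

text \<open>
  Hom-sets of different pairs of objects need not be disjoint, so the composition and the arrow
  part of a functor are indexed by the objects: \<open>Cmp C X Y Z g f\<close> is the composite of
  \<open>f : X \<rightarrow> Y\<close> and \<open>g : Y \<rightarrow> Z\<close>.
\<close>

record ('o, 'm) cat =
  Obj :: "'o set"
  Hom :: "'o \<Rightarrow> 'o \<Rightarrow> 'm set"
  Ide :: "'o \<Rightarrow> 'm"
  Cmp :: "'o \<Rightarrow> 'o \<Rightarrow> 'o \<Rightarrow> 'm \<Rightarrow> 'm \<Rightarrow> 'm"

definition category :: "('o, 'm) cat \<Rightarrow> bool" where
  "category C \<longleftrightarrow>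
    (\<forall>X\<in>Obj C. Ide C X \<in> Hom C X X) \<and>
    (\<forall>X\<in>Obj C. \<forall>Y\<in>Obj C. \<forall>Z\<in>Obj C. \<forall>f\<in>Hom C X Y. \<forall>g\<in>Hom C Y Z.
        Cmp C X Y Z g f \<in> Hom C X Z) \<and>
    (\<forall>X\<in>Obj C. \<forall>Y\<in>Obj C. \<forall>f\<in>Hom C X Y.
        Cmp C X X Y f (Ide C X) = f \<and> Cmp C X Y Y (Ide C Y) f = f) \<and>
    (\<forall>W\<in>Obj C. \<forall>X\<in>Obj C. \<forall>Y\<in>Obj C. \<forall>Z\<in>Obj C.
      \<forall>f\<in>Hom C W X. \<forall>g\<in>Hom C X Y. \<forall>h\<in>Hom C Y Z.
        Cmp C W Y Z h (Cmp C W X Y g f) = Cmp C W X Z (Cmp C X Y Z h g) f)"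

definition full_subcategory :: "('o, 'm) cat \<Rightarrow> 'o set \<Rightarrow> ('o, 'm) cat" where
  "full_subcategory C K = C\<lparr>Obj := Obj C \<inter> K\<rparr>"

definition iso_arrow :: "('o, 'm) cat \<Rightarrow> 'o \<Rightarrow> 'o \<Rightarrow> 'm \<Rightarrow> bool" where
  "iso_arrow C X Y f \<longleftrightarrow> f \<in> Hom C X Y \<and>
    (\<exists>g\<in>Hom C Y X. Cmp C X Y X g f = Ide C X \<and> Cmp C Y X Y f g = Ide C Y)"

record ('o, 'm, 'p, 'n) fctr =
  omap :: "'o \<Rightarrow> 'p"
  amap :: "'o \<Rightarrow> 'o \<Rightarrow> 'm \<Rightarrow> 'n"

definition covariant_functor ::
  "('o, 'm) cat \<Rightarrow> ('p, 'n) cat \<Rightarrow> ('o, 'm, 'p, 'n) fctr \<Rightarrow> bool" where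
  "covariant_functor C D F \<longleftrightarrow>
    (\<forall>X\<in>Obj C. omap F X \<in> Obj D) \<and>
    (\<forall>X\<in>Obj C. \<forall>Y\<in>Obj C. \<forall>f\<in>Hom C X Y. amap F X Y f \<in> Hom D (omap F X) (omap F Y)) \<and>
    (\<forall>X\<in>Obj C. amap F X X (Ide C X) = Ide D (omap F X)) \<and>
    (\<forall>X\<in>Obj C. \<forall>Y\<in>Obj C. \<forall>Z\<in>Obj C. \<forall>f\<in>Hom C X Y. \<forall>g\<in>Hom C Y Z.
        amap F X Z (Cmp C X Y Z g f) =
          Cmp D (omap F X) (omap F Y) (omap F Z) (amap F Y Z g) (amap F X Y f))"

definition contravariant_functor ::
  "('o, 'm) cat \<Rightarrow> ('p, 'n) cat \<Rightarrow> ('o, 'm, 'p, 'n) fctr \<Rightarrow> bool" where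
  "contravariant_functor C D F \<longleftrightarrow>
    (\<forall>X\<in>Obj C. omap F X \<in> Obj D) \<and>
    (\<forall>X\<in>Obj C. \<forall>Y\<in>Obj C. \<forall>f\<in>Hom C X Y. amap F X Y f \<in> Hom D (omap F Y) (omap F X)) \<and>
    (\<forall>X\<in>Obj C. amap F X X (Ide C X) = Ide D (omap F X)) \<and>
    (\<forall>X\<in>Obj C. \<forall>Y\<in>Obj C. \<forall>Z\<in>Obj C. \<forall>f\<in>Hom C X Y. \<forall>g\<in>Hom C Y Z.
        amap F X Z (Cmp C X Y Z g f) =
          Cmp D (omap F Z) (omap F Y) (omap F X) (amap F X Y f) (amap F Y Z g))"

definition id_functor :: "('o, 'm, 'o, 'm) fctr" where
  "id_functor = \<lparr>omap = (\<lambda>X. X), amap = (\<lambda>X Y f. f)\<rparr>"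

text \<open>The (covariant) composite of two contravariant functors, first \<open>F\<close>, then \<open>G\<close>.\<close>

definition contra_comp ::
  "('p, 'n, 'q, 'k) fctr \<Rightarrow> ('o, 'm, 'p, 'n) fctr \<Rightarrow> ('o, 'm, 'q, 'k) fctr" where
  "contra_comp G F =
    \<lparr>omap = (\<lambda>X. omap G (omap F X)),
     amap = (\<lambda>X Y f. amap G (omap F Y) (omap F X) (amap F X Y f))\<rparr>"

definition naturally_isomorphic ::
  "('o, 'm) cat \<Rightarrow> ('p, 'n) cat \<Rightarrow> ('o, 'm, 'p, 'n) fctr \<Rightarrow> ('o, 'm, 'p, 'n) fctr \<Rightarrow> bool" where
  "naturally_isomorphic C D F G \<longleftrightarrow>
    covariant_functor C D F \<and> covariant_functor C D G \<and>
    (\<exists>\<eta>. (\<forall>X\<in>Obj C. iso_arrow D (omap F X) (omap G X) (\<eta> X)) \<and>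
      (\<forall>X\<in>Obj C. \<forall>Y\<in>Obj C. \<forall>f\<in>Hom C X Y.
        Cmp D (omap F X) (omap G X) (omap G Y) (amap G X Y f) (\<eta> X) =
        Cmp D (omap F X) (omap F Y) (omap G Y) (\<eta> Y) (amap F X Y f)))"

definition dually_equivalent :: "('o, 'm) cat \<Rightarrow> ('p, 'n) cat \<Rightarrow> bool" where
  "dually_equivalent C D \<longleftrightarrow> category C \<and> category D \<and>
    (\<exists>F G. contravariant_functor C D F \<and> contravariant_functor D C G \<and>
      naturally_isomorphic C C (contra_comp G F) id_functor \<and>
      naturally_isomorphic D D (contra_comp F G) id_functor)"


section \<open>Extremally disconnected Tychonoff spaces\<close>

definition tychonoff_space :: "'u topology \<Rightarrow> bool" where
  "tychonoff_space X \<longleftrightarrow> completely_regular_space X \<and> Hausdorff_space X"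

definition extremally_disconnected_space :: "'u topology \<Rightarrow> bool" where
  "extremally_disconnected_space X \<longleftrightarrow> (\<forall>U. openin X U \<longrightarrow> openin X (X closure_of U))"

text \<open>
  A function on a set is represented by an element of \<^term>\<open>extensional A\<close>, so that arrows that
  agree on their domain are equal.
\<close>

definition EDTych :: "('u topology, 'u \<Rightarrow> 'u) cat" where
  "EDTych =
    \<lparr>Obj = {X. tychonoff_space X \<and> extremally_disconnected_space X},
     Hom = (\<lambda>X Y. {f \<in> extensional (topspace X). continuous_map X Y f}),
     Ide = (\<lambda>X. \<lambda>x\<in>topspace X. x),
     Cmp = (\<lambda>X Y Z g f. compose (topspace X) g f)\<rparr>"


section \<open>Boolean z-algebras\<close>

definition boolean_lattice :: "'v gorder \<Rightarrow> bool" where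
  "boolean_lattice A \<longleftrightarrow> bounded_lattice A \<and>
    (\<forall>a\<in>carrier A. \<forall>b\<in>carrier A. \<forall>c\<in>carrier A.
        a \<sqinter>\<^bsub>A\<^esub> (b \<squnion>\<^bsub>A\<^esub> c) = (a \<sqinter>\<^bsub>A\<^esub> b) \<squnion>\<^bsub>A\<^esub> (a \<sqinter>\<^bsub>A\<^esub> c)) \<and>
    (\<forall>a\<in>carrier A. \<exists>b\<in>carrier A. a \<squnion>\<^bsub>A\<^esub> b = \<top>\<^bsub>A\<^esub> \<and> a \<sqinter>\<^bsub>A\<^esub> b = \<bottom>\<^bsub>A\<^esub>)"

text \<open>
  Homomorphisms of Boolean algebras; preservation of complements follows from the clauses below.
\<close>

definition boolean_hom :: "'v gorder \<Rightarrow> 'w gorder \<Rightarrow> ('v \<Rightarrow> 'w) set" where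
  "boolean_hom A B = {h \<in> carrier A \<rightarrow>\<^sub>E carrier B.
    h \<bottom>\<^bsub>A\<^esub> = \<bottom>\<^bsub>B\<^esub> \<and> h \<top>\<^bsub>A\<^esub> = \<top>\<^bsub>B\<^esub> \<and>
    (\<forall>a\<in>carrier A. \<forall>b\<in>carrier A.
        h (a \<squnion>\<^bsub>A\<^esub> b) = h a \<squnion>\<^bsub>B\<^esub> h b \<and> h (a \<sqinter>\<^bsub>A\<^esub> b) = h a \<sqinter>\<^bsub>B\<^esub> h b)}"

definition two :: "bool gorder" where
  "two = \<lparr>carrier = UNIV, eq = (=), le = (\<le>)\<rparr>"

type_synonym 'v zalg = "'v gorder \<times> ('v \<Rightarrow> bool) set"

definition z_algebra :: "'v zalg \<Rightarrow> bool" where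
  "z_algebra = (\<lambda>(A, X). boolean_lattice A \<and> X \<subseteq> boolean_hom A two \<and>
    (\<forall>a \<in> carrier A - {\<bottom>\<^bsub>A\<^esub>}. \<exists>x\<in>X. x a = \<top>\<^bsub>two\<^esub>))"

definition zBoole :: "('v zalg, ('v \<Rightarrow> 'v) \<times> (('v \<Rightarrow> bool) \<Rightarrow> ('v \<Rightarrow> bool))) cat" where
  "zBoole =
    \<lparr>Obj = {Z. z_algebra Z},
     Hom = (\<lambda>(A, X) (A', X'). {(\<phi>, f). \<phi> \<in> boolean_hom A A' \<and> f \<in> X' \<rightarrow>\<^sub>E X \<and>
              (\<forall>x'\<in>X'. compose (carrier A) x' \<phi> = f x')}),
     Ide = (\<lambda>(A, X). (\<lambda>a\<in>carrier A. a, \<lambda>x\<in>X. x)),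
     Cmp = (\<lambda>(A, X) (A', X') (A'', X'') (\<phi>', f') (\<phi>, f).
              (compose (carrier A) \<phi>' \<phi>, compose X'' f f'))\<rparr>"

definition zCBoole :: "('v zalg, ('v \<Rightarrow> 'v) \<times> (('v \<Rightarrow> bool) \<Rightarrow> ('v \<Rightarrow> bool))) cat" where
  "zCBoole = full_subcategory zBoole {(A, X). complete_lattice A}"


section \<open>Size\<close>

text \<open>
  The categories above consist of all structures with points, respectively elements, in one HOL
  type. No single type need be closed under the passage from a space to its algebra of clopen sets
  and from an algebra to its set of homomorphisms, so ``all spaces'' has to be read relative to a
  universe of small sets. Of the closure properties of a Grothendieck universe only the two below
  are required; the sets in \<open>U\<close> may be finite or infinite.
\<close>

definition universe :: "'w set set \<Rightarrow> bool" where
  "universe U \<longleftrightarrow>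
    (\<forall>A\<in>U. \<forall>B :: 'w set. B \<lesssim> A \<longrightarrow> B \<in> U) \<and>
    (\<forall>A\<in>U. \<exists>B\<in>U. Pow A \<lesssim> B)"

definition EDTych_small :: "'w set set \<Rightarrow> ('w topology, 'w \<Rightarrow> 'w) cat" where
  "EDTych_small U = full_subcategory EDTych {X. topspace X \<in> U}"

definition zCBoole_small ::
    "'w set set \<Rightarrow> ('w zalg, ('w \<Rightarrow> 'w) \<times> (('w \<Rightarrow> bool) \<Rightarrow> ('w \<Rightarrow> bool))) cat" where
  "zCBoole_small U = full_subcategory zCBoole {(A, X). carrier A \<in> U}"

text \<open>
  HOL does not prove that a type with a universe containing an infinite set exists. The following
  two categories need no universe: a space with points in \<open>'u\<close> is kept if its clopen sets can be
  indexed by \<open>'v\<close>, a z-algebra with elements in \<open>'v\<close> is kept if its points can be indexed by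
  \<open>'u\<close>. For \<open>'v = 'u set\<close> no space is omitted, and for \<open>'u = 'v \<Rightarrow> bool\<close> no z-algebra is.
\<close>

definition EDTych_bounded :: "'v itself \<Rightarrow> ('u topology, 'u \<Rightarrow> 'u) cat" where
  "EDTych_bounded _ =
    full_subcategory EDTych {X. {S. openin X S \<and> closedin X S} \<lesssim> (UNIV :: 'v set)}"

definition zCBoole_bounded ::
    "'u itself \<Rightarrow> ('v zalg, ('v \<Rightarrow> 'v) \<times> (('v \<Rightarrow> bool) \<Rightarrow> ('v \<Rightarrow> bool))) cat" where
  "zCBoole_bounded _ = full_subcategory zCBoole {(A, X). X \<lesssim> (UNIV :: 'u set)}"

lemma EDTych_bounded_all: "EDTych_bounded TYPE('u set) = (EDTych :: ('u topology, _) cat)"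
proof -
  have "{S. openin X S \<and> closedin X S} \<lesssim> (UNIV :: 'u set set)" for X :: "'u topology"
    by (simp add: subset_imp_lepoll)
  then show ?thesis
    by (simp add: EDTych_bounded_def full_subcategory_def)
qed

lemma zCBoole_bounded_all: "zCBoole_bounded TYPE('v \<Rightarrow> bool) = (zCBoole :: ('v zalg, _) cat)"
proof -
  have "{(A :: 'v gorder, X). X \<lesssim> (UNIV :: ('v \<Rightarrow> bool) set)} = (UNIV :: 'v zalg set)"
    by (auto simp: subset_imp_lepoll)
  then show ?thesis
    by (simp add: zCBoole_bounded_def full_subcategory_def)
qed

end

(*
  A full, faithful and essentially surjective contravariant functor determines a dual equivalence.
  Here it sends a z-algebra (A, X) to the set X with the sets {x. x a} as a base of clopen sets, and
  an arrow (phi, f) to f. If A is complete, the closure of a union of basic sets {x. x a} is the basic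
  set of the supremum of the a's, because every nonzero element has a point; so the space is
  extremally disconnected and its clopen sets are exactly the basic ones. This gives fullness:
  a continuous map pulls basic sets back to basic sets. Conversely, in an extremally disconnected
  regular space closures of open sets form a base of clopen sets, and the clopen sets are a complete
  Boolean algebra, whose evaluations at points recover the space.
*)

theory Submission
  imports Defs
begin

section \<open>Dual equivalences from a single functor\<close>

text \<open>For an algebra taken with all its homomorphisms into \<open>two\<close>, compactness is
  what makes every clopen set basic. Here \<open>X\<close> is only required to detect nonzero
  elements, so the space need not be compact, and completeness of the algebra takes over that role.
  Points need not preserve infinite suprema: a point may send a supremum to 1 and every member of
  the family to 0. Such points are exactly what the closure adds to the union of the basic sets.

  The functor starts from algebras because an arrow there already carries its map of points.
  Functoriality is then immediate, and the content sits in fullness, where \<open>\<phi>\<close> has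
  to be recovered from \<open>f\<close>.

  A second obstacle is typing. Points of an algebra over \<open>'v\<close> have type
  \<open>'v \<Rightarrow> bool\<close> and clopen sets of a space over \<open>'u\<close> have type
  \<open>'u set\<close>, so neither construction lands in the other category as it stands.
  Injections \<open>e\<close> and \<open>i\<close>, chosen separately for each object, move them;
  any choice will do, since an equivalence sees objects only up to isomorphism.\<close>

lemma
  assumes "category C"
  shows category_Ide: "X \<in> Obj C \<Longrightarrow> Ide C X \<in> Hom C X X"
    and category_Cmp: "\<lbrakk>X \<in> Obj C; Y \<in> Obj C; Z \<in> Obj C; f \<in> Hom C X Y; g \<in> Hom C Y Z\<rbrakk>
          \<Longrightarrow> Cmp C X Y Z g f \<in> Hom C X Z"
    and category_Cmp_Ide: "\<lbrakk>X \<in> Obj C; Y \<in> Obj C; f \<in> Hom C X Y\<rbrakk> \<Longrightarrow> Cmp C X X Y f (Ide C X) = f"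
    and category_Ide_Cmp: "\<lbrakk>X \<in> Obj C; Y \<in> Obj C; f \<in> Hom C X Y\<rbrakk> \<Longrightarrow> Cmp C X Y Y (Ide C Y) f = f"
    and category_assoc: "\<lbrakk>W \<in> Obj C; X \<in> Obj C; Y \<in> Obj C; Z \<in> Obj C;
          f \<in> Hom C W X; g \<in> Hom C X Y; h \<in> Hom C Y Z\<rbrakk>
          \<Longrightarrow> Cmp C W X Z (Cmp C X Y Z h g) f = Cmp C W Y Z h (Cmp C W X Y g f)"
  using assms unfolding category_def by simp_all

lemma full_subcategory_simps [simp]:
  "Obj (full_subcategory C K) = Obj C \<inter> K"
  "Hom (full_subcategory C K) = Hom C"
  "Ide (full_subcategory C K) = Ide C"
  "Cmp (full_subcategory C K) = Cmp C"
  by (simp_all add: full_subcategory_def)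

lemma category_full_subcategory: "category C \<Longrightarrow> category (full_subcategory C K)"
  unfolding category_def full_subcategory_simps by (auto 0 0)

text \<open>The missing functor is forced. Choose an isomorphism \<open>u X\<close> from
  \<open>X\<close> to \<open>G (K X)\<close> with inverse \<open>v X\<close>; an arrow
  \<open>f\<close> from \<open>X\<close> to \<open>Y\<close> must go to the unique arrow that
  \<open>G\<close> sends to the composite of \<open>v X\<close>, \<open>f\<close> and
  \<open>u Y\<close>. Every equation between arrows of \<open>D\<close> is then checked after
  applying \<open>G\<close>, which is injective on hom-sets (\<open>inj\<close>).\<close>

lemma dually_equivalentI:
  fixes C :: "('o, 'm) cat" and D :: "('p, 'n) cat"
  assumes C: "category C" and D: "category D" and G: "contravariant_functor D C G"
    and full_faithful: "\<And>Z Z' f. \<lbrakk>Z \<in> Obj D; Z' \<in> Obj D; f \<in> Hom C (omap G Z') (omap G Z)\<rbrakk>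
          \<Longrightarrow> \<exists>!h. h \<in> Hom D Z Z' \<and> amap G Z Z' h = f"
    and ess_surj: "\<And>X. X \<in> Obj C \<Longrightarrow> \<exists>Z\<in>Obj D. \<exists>u. iso_arrow C X (omap G Z) u"
  shows "dually_equivalent C D"
proof -
  let ?G = "omap G"
  have GO: "?G Z \<in> Obj C" if "Z \<in> Obj D" for Z
    using G that by (auto simp: contravariant_functor_def)
  have GH: "amap G Z Z' h \<in> Hom C (?G Z') (?G Z)"
    if "Z \<in> Obj D" "Z' \<in> Obj D" "h \<in> Hom D Z Z'" for Z Z' h
    using G that by (auto simp: contravariant_functor_def)
  have GI: "amap G Z Z (Ide D Z) = Ide C (?G Z)" if "Z \<in> Obj D" for Z
    using G that by (auto simp: contravariant_functor_def)
  have GC: "amap G X Z (Cmp D X Y Z g f) = Cmp C (?G Z) (?G Y) (?G X) (amap G X Y f) (amap G Y Z g)"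
    if "X \<in> Obj D" "Y \<in> Obj D" "Z \<in> Obj D" "f \<in> Hom D X Y" "g \<in> Hom D Y Z" for X Y Z f g
    using G that by (auto simp: contravariant_functor_def)
  have "\<forall>X\<in>Obj C. \<exists>Z u v. Z \<in> Obj D \<and> u \<in> Hom C X (?G Z) \<and> v \<in> Hom C (?G Z) X \<and>
      Cmp C X (?G Z) X v u = Ide C X \<and> Cmp C (?G Z) X (?G Z) u v = Ide C (?G Z)"
    using ess_surj unfolding iso_arrow_def by meson
  then obtain K u v where
    KO: "\<And>X. X \<in> Obj C \<Longrightarrow> K X \<in> Obj D" and
    u: "\<And>X. X \<in> Obj C \<Longrightarrow> u X \<in> Hom C X (?G (K X))" and
    v: "\<And>X. X \<in> Obj C \<Longrightarrow> v X \<in> Hom C (?G (K X)) X" and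
    vu: "\<And>X. X \<in> Obj C \<Longrightarrow> Cmp C X (?G (K X)) X (v X) (u X) = Ide C X" and
    uv: "\<And>X. X \<in> Obj C \<Longrightarrow> Cmp C (?G (K X)) X (?G (K X)) (u X) (v X) = Ide C (?G (K X))"
    by metis
  note C_simps = category_Ide[OF C] category_Cmp[OF C] category_Cmp_Ide[OF C]
    category_Ide_Cmp[OF C] category_assoc[OF C]
  note D_simps = category_Ide[OF D] category_Cmp[OF D] category_Cmp_Ide[OF D]
    category_Ide_Cmp[OF D] category_assoc[OF D]
  note G_simps = GO GH GI GC KO u v vu uv
  \<comment> \<open>\<open>category_assoc\<close> brackets composites to the right, so inside a
    longer composite \<open>v X\<close> and \<open>u X\<close> are not adjacent as a subterm and
    \<open>vu\<close> cannot fire. These two variants cancel them in front of a tail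
    \<open>t\<close>.\<close>
  have vu': "Cmp C W (?G (K X)) X (v X) (Cmp C W X (?G (K X)) (u X) t) = t"
    if "W \<in> Obj C" "X \<in> Obj C" "t \<in> Hom C W X" for W X t
    using that by (simp add: C_simps G_simps flip: category_assoc[OF C])
  have uv': "Cmp C W X (?G (K X)) (u X) (Cmp C W (?G (K X)) X (v X) t) = t"
    if "W \<in> Obj C" "X \<in> Obj C" "t \<in> Hom C W (?G (K X))" for W X t
    using that by (simp add: C_simps G_simps flip: category_assoc[OF C])
  define L where "L Z Z' f = (THE h. h \<in> Hom D Z Z' \<and> amap G Z Z' h = f)" for Z Z' f
  have L: "L Z Z' f \<in> Hom D Z Z' \<and> amap G Z Z' (L Z Z' f) = f"
    if "Z \<in> Obj D" "Z' \<in> Obj D" "f \<in> Hom C (?G Z') (?G Z)" for Z Z' f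
    unfolding L_def using full_faithful[OF that] by (rule theI')
  have inj: "h = h'" if "amap G Z Z' h = amap G Z Z' h'" "Z \<in> Obj D" "Z' \<in> Obj D"
      "h \<in> Hom D Z Z'" "h' \<in> Hom D Z Z'" for Z Z' h h'
    using full_faithful[of Z Z' "amap G Z Z' h"] that GH by metis
  define F :: "('o, 'm, 'p, 'n) fctr" where
    "F = \<lparr>omap = K, amap = (\<lambda>X Y f. L (K Y) (K X)
        (Cmp C (?G (K X)) Y (?G (K Y)) (u Y) (Cmp C (?G (K X)) X Y f (v X))))\<rparr>"
  have FO [simp]: "omap F = K"
    by (simp add: F_def)
  have F: "amap F X Y f \<in> Hom D (K Y) (K X) \<and> amap G (K Y) (K X) (amap F X Y f) =
      Cmp C (?G (K X)) Y (?G (K Y)) (u Y) (Cmp C (?G (K X)) X Y f (v X))"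
    if "X \<in> Obj C" "Y \<in> Obj C" "f \<in> Hom C X Y" for X Y f
    using L that by (simp add: F_def C_simps G_simps)
  note FH = F[THEN conjunct1] and GF = F[THEN conjunct2]
  have contraF: "contravariant_functor C D F"
    unfolding contravariant_functor_def FO
  proof (intro conjI ballI)
    fix X assume X: "X \<in> Obj C"
    show "amap F X X (Ide C X) = Ide D (K X)"
      by (rule inj[where Z = "K X" and Z' = "K X"])
        (use X in \<open>simp_all add: GF FH C_simps D_simps G_simps vu' uv'\<close>)
  next
    fix X Y Z f g
    assume *: "X \<in> Obj C" "Y \<in> Obj C" "Z \<in> Obj C" "f \<in> Hom C X Y" "g \<in> Hom C Y Z"
    show "amap F X Z (Cmp C X Y Z g f) = Cmp D (K Z) (K Y) (K X) (amap F X Y f) (amap F Y Z g)"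
      by (rule inj[where Z = "K Z" and Z' = "K X"])
        (use * in \<open>simp_all add: GF FH C_simps D_simps G_simps vu' uv'\<close>)
  qed (auto simp: KO FH)
  \<comment> \<open>The lifts of \<open>u\<close> and \<open>v\<close> at \<open>G Z\<close> along
    \<open>G\<close>. They are mutually inverse because their images are, and \<open>G\<close> is
    faithful.\<close>
  define \<epsilon> where "\<epsilon> Z = L (K (?G Z)) Z (u (?G Z))" for Z
  define \<delta> where "\<delta> Z = L Z (K (?G Z)) (v (?G Z))" for Z
  have \<epsilon>: "\<epsilon> Z \<in> Hom D (K (?G Z)) Z" "amap G (K (?G Z)) Z (\<epsilon> Z) = u (?G Z)" if "Z \<in> Obj D" for Z
    using L[of "K (?G Z)" Z "u (?G Z)"] that by (simp_all add: G_simps \<epsilon>_def)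
  have \<delta>: "\<delta> Z \<in> Hom D Z (K (?G Z))" "amap G Z (K (?G Z)) (\<delta> Z) = v (?G Z)" if "Z \<in> Obj D" for Z
    using L[of Z "K (?G Z)" "v (?G Z)"] that by (simp_all add: G_simps \<delta>_def)
  have "naturally_isomorphic C C (contra_comp G F) id_functor"
    unfolding naturally_isomorphic_def
  proof (intro conjI exI[of _ v] ballI)
    show "covariant_functor C C (contra_comp G F)" "covariant_functor C C id_functor"
      using G contraF by (auto simp: covariant_functor_def contravariant_functor_def
          contra_comp_def id_functor_def C_simps)
  next
    fix X assume "X \<in> Obj C"
    then show "iso_arrow C (omap (contra_comp G F) X) (omap id_functor X) (v X)"
      by (auto simp: iso_arrow_def contra_comp_def id_functor_def G_simps intro!: bexI[of _ "u X"])
  next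
    fix X Y f assume "X \<in> Obj C" "Y \<in> Obj C" "f \<in> Hom C X Y"
    then show "Cmp C (omap (contra_comp G F) X) (omap id_functor X) (omap id_functor Y)
          (amap id_functor X Y f) (v X) =
        Cmp C (omap (contra_comp G F) X) (omap (contra_comp G F) Y) (omap id_functor Y)
          (v Y) (amap (contra_comp G F) X Y f)"
      by (simp add: contra_comp_def id_functor_def GF C_simps G_simps vu' uv')
  qed
  moreover have "naturally_isomorphic D D (contra_comp F G) id_functor"
    unfolding naturally_isomorphic_def
  proof (intro conjI exI[of _ \<epsilon>] ballI)
    show "covariant_functor D D (contra_comp F G)" "covariant_functor D D id_functor"
      using G contraF by (auto simp: covariant_functor_def contravariant_functor_def
          contra_comp_def id_functor_def D_simps)
  next
    fix Z assume Z: "Z \<in> Obj D"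
    have "Cmp D (K (?G Z)) Z (K (?G Z)) (\<delta> Z) (\<epsilon> Z) = Ide D (K (?G Z))"
      by (rule inj[where Z = "K (?G Z)" and Z' = "K (?G Z)"])
        (use Z in \<open>simp_all add: \<epsilon> \<delta> D_simps G_simps\<close>)
    moreover have "Cmp D Z (K (?G Z)) Z (\<epsilon> Z) (\<delta> Z) = Ide D Z"
      by (rule inj[where Z = Z and Z' = Z]) (use Z in \<open>simp_all add: \<epsilon> \<delta> D_simps G_simps\<close>)
    ultimately show "iso_arrow D (omap (contra_comp F G) Z) (omap id_functor Z) (\<epsilon> Z)"
      using Z by (auto simp: iso_arrow_def contra_comp_def id_functor_def \<epsilon> \<delta> intro!: bexI[of _ "\<delta> Z"])
  next
    fix Z Z' h assume *: "Z \<in> Obj D" "Z' \<in> Obj D" "h \<in> Hom D Z Z'"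
    have "Cmp D (K (?G Z)) Z Z' h (\<epsilon> Z) =
        Cmp D (K (?G Z)) (K (?G Z')) Z' (\<epsilon> Z') (amap F (?G Z') (?G Z) (amap G Z Z' h))"
      by (rule inj[where Z = "K (?G Z)" and Z' = Z'])
        (use * in \<open>simp_all add: \<epsilon> GF FH C_simps D_simps G_simps vu' uv'\<close>)
    then show "Cmp D (omap (contra_comp F G) Z) (omap id_functor Z) (omap id_functor Z')
          (amap id_functor Z Z' h) (\<epsilon> Z) =
        Cmp D (omap (contra_comp F G) Z) (omap (contra_comp F G) Z') (omap id_functor Z')
          (\<epsilon> Z') (amap (contra_comp F G) Z Z' h)"
      by (simp add: contra_comp_def id_functor_def)
  qed
  ultimately show ?thesis
    using C D G contraF unfolding dually_equivalent_def by blast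
qed


section \<open>The points of a z-algebra\<close>

lemma two_simps:
  "\<bottom>\<^bsub>two\<^esub> = False" "\<top>\<^bsub>two\<^esub> = True"
  "p \<squnion>\<^bsub>two\<^esub> q \<longleftrightarrow> p \<or> q" "p \<sqinter>\<^bsub>two\<^esub> q \<longleftrightarrow> p \<and> q"
proof -
  show "\<bottom>\<^bsub>two\<^esub> = False" "\<top>\<^bsub>two\<^esub> = True"
    unfolding bottom_def top_def two_def least_def greatest_def
    by (rule some_equality; force)+
  show "p \<squnion>\<^bsub>two\<^esub> q \<longleftrightarrow> p \<or> q"
    unfolding join_def Lattice.sup_def two_def least_def Upper_def
    by (rule some_equality; simp; blast)
  show "p \<sqinter>\<^bsub>two\<^esub> q \<longleftrightarrow> p \<and> q"
    unfolding meet_def Lattice.inf_def two_def greatest_def Lower_def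
    by (rule some_equality; simp; blast)
qed

context
  fixes A :: "'v gorder" and X :: "('v \<Rightarrow> bool) set"
  assumes zalg: "z_algebra (A, X)"
begin

interpretation bounded_lattice A
  using zalg by (simp add: z_algebra_def boolean_lattice_def)

lemma z_algebra_point:
  assumes "x \<in> X"
  shows "x \<in> extensional (carrier A)" "\<not> x \<bottom>\<^bsub>A\<^esub>" "x \<top>\<^bsub>A\<^esub>"
    and "\<lbrakk>a \<in> carrier A; b \<in> carrier A\<rbrakk> \<Longrightarrow> x (a \<squnion>\<^bsub>A\<^esub> b) \<longleftrightarrow> x a \<or> x b"
    and "\<lbrakk>a \<in> carrier A; b \<in> carrier A\<rbrakk> \<Longrightarrow> x (a \<sqinter>\<^bsub>A\<^esub> b) \<longleftrightarrow> x a \<and> x b"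
proof -
  have "x \<in> boolean_hom A two"
    using assms zalg by (auto simp: z_algebra_def)
  then show "x \<in> extensional (carrier A)" "\<not> x \<bottom>\<^bsub>A\<^esub>" "x \<top>\<^bsub>A\<^esub>"
    and "\<lbrakk>a \<in> carrier A; b \<in> carrier A\<rbrakk> \<Longrightarrow> x (a \<squnion>\<^bsub>A\<^esub> b) \<longleftrightarrow> x a \<or> x b"
    and "\<lbrakk>a \<in> carrier A; b \<in> carrier A\<rbrakk> \<Longrightarrow> x (a \<sqinter>\<^bsub>A\<^esub> b) \<longleftrightarrow> x a \<and> x b"
    by (auto simp: boolean_hom_def PiE_def two_simps)
qed

text \<open>A point preserves joins, meets, top and bottom, so of two complementary elements it
  sends exactly one to True.\<close>

lemma z_algebra_complement:
  assumes "a \<in> carrier A"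
  obtains b where "b \<in> carrier A" "a \<squnion>\<^bsub>A\<^esub> b = \<top>\<^bsub>A\<^esub>" "a \<sqinter>\<^bsub>A\<^esub> b = \<bottom>\<^bsub>A\<^esub>"
    "\<And>x. x \<in> X \<Longrightarrow> x b \<longleftrightarrow> \<not> x a"
proof -
  obtain b where b: "b \<in> carrier A" "a \<squnion>\<^bsub>A\<^esub> b = \<top>\<^bsub>A\<^esub>" "a \<sqinter>\<^bsub>A\<^esub> b = \<bottom>\<^bsub>A\<^esub>"
    using zalg assms by (auto simp: z_algebra_def boolean_lattice_def)
  moreover have "x b \<longleftrightarrow> \<not> x a" if "x \<in> X" for x
    using z_algebra_point[OF that] b assms by metis
  ultimately show ?thesis
    using that by blast
qed

lemma z_algebra_eq_bottom:
  assumes "a \<in> carrier A" "\<And>x. x \<in> X \<Longrightarrow> \<not> x a"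
  shows "a = \<bottom>\<^bsub>A\<^esub>"
  using assms zalg by (auto simp: z_algebra_def two_simps)

text \<open>With \<open>c\<close> a complement of \<open>b\<close>, no point is true at both
  \<open>a\<close> and \<open>c\<close>, so their meet is zero because nonzero elements have points.
  Distributing \<open>a\<close> over the join of \<open>b\<close> and \<open>c\<close> then leaves
  \<open>a\<close> equal to its meet with \<open>b\<close>. Consequently elements may be compared
  through their points.\<close>

lemma z_algebra_le_iff:
  assumes a: "a \<in> carrier A" and b: "b \<in> carrier A"
  shows "a \<sqsubseteq>\<^bsub>A\<^esub> b \<longleftrightarrow> (\<forall>x\<in>X. x a \<longrightarrow> x b)"
proof
  assume "a \<sqsubseteq>\<^bsub>A\<^esub> b"
  then show "\<forall>x\<in>X. x a \<longrightarrow> x b"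
    using le_iff_join[OF a b] z_algebra_point(5)[OF _ a b] by metis
next
  assume ab: "\<forall>x\<in>X. x a \<longrightarrow> x b"
  obtain c where c: "c \<in> carrier A" "b \<squnion>\<^bsub>A\<^esub> c = \<top>\<^bsub>A\<^esub>" "\<And>x. x \<in> X \<Longrightarrow> x c \<longleftrightarrow> \<not> x b"
    using z_algebra_complement[OF b] by metis
  have ac: "a \<sqinter>\<^bsub>A\<^esub> c = \<bottom>\<^bsub>A\<^esub>"
    using ab a c by (intro z_algebra_eq_bottom) (auto simp: z_algebra_point)
  have "a \<sqinter>\<^bsub>A\<^esub> (b \<squnion>\<^bsub>A\<^esub> c) = (a \<sqinter>\<^bsub>A\<^esub> b) \<squnion>\<^bsub>A\<^esub> (a \<sqinter>\<^bsub>A\<^esub> c)"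
    using zalg a b c(1) by (simp add: z_algebra_def boolean_lattice_def)
  then have "a \<sqinter>\<^bsub>A\<^esub> \<top>\<^bsub>A\<^esub> = (a \<sqinter>\<^bsub>A\<^esub> b) \<squnion>\<^bsub>A\<^esub> \<bottom>\<^bsub>A\<^esub>"
    by (simp add: c(2) ac)
  then have "a = a \<sqinter>\<^bsub>A\<^esub> b"
    using top_meet[OF a] bottom_join[of "a \<sqinter>\<^bsub>A\<^esub> b"] a b
    by (simp add: eq_is_equal meet_comm join_comm)
  then show "a \<sqsubseteq>\<^bsub>A\<^esub> b"
    using le_iff_join[OF a b] by simp
qed

lemma z_algebra_eqI:
  assumes "a \<in> carrier A" "b \<in> carrier A" "\<And>x. x \<in> X \<Longrightarrow> x a \<longleftrightarrow> x b"
  shows "a = b"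
  using assms by (intro le_antisym) (auto simp: z_algebra_le_iff)

end


section \<open>The space of a z-algebra\<close>

text \<open>The points are moved along an injection \<open>e\<close> into the type of points of the target spaces.\<close>

definition stone_topology :: "(('v \<Rightarrow> bool) \<Rightarrow> 'u) \<Rightarrow> 'v zalg \<Rightarrow> 'u topology" where
  "stone_topology e = (\<lambda>(A, X). topology (\<lambda>U. U \<subseteq> e ` X \<and>
      (\<forall>x\<in>X. e x \<in> U \<longrightarrow> (\<exists>a\<in>carrier A. x a \<and> (\<forall>y\<in>X. y a \<longrightarrow> e y \<in> U)))))"

context
  fixes A :: "'v gorder" and X :: "('v \<Rightarrow> bool) set" and e :: "('v \<Rightarrow> bool) \<Rightarrow> 'u"
  assumes zalg: "z_algebra (A, X)" and inj: "inj_on e X"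
begin

interpretation bounded_lattice A
  using zalg by (simp add: z_algebra_def boolean_lattice_def)

text \<open>\<open>topology\<close> has the prescribed open sets only once \<open>istopology\<close>
  is established. Intersections work because a point is true at a meet iff it is true at both
  elements.\<close>

lemma openin_stone_topology:
  "openin (stone_topology e (A, X)) U \<longleftrightarrow> U \<subseteq> e ` X \<and>
      (\<forall>x\<in>X. e x \<in> U \<longrightarrow> (\<exists>a\<in>carrier A. x a \<and> (\<forall>y\<in>X. y a \<longrightarrow> e y \<in> U)))"
proof -
  have "istopology (\<lambda>U. U \<subseteq> e ` X \<and>
      (\<forall>x\<in>X. e x \<in> U \<longrightarrow> (\<exists>a\<in>carrier A. x a \<and> (\<forall>y\<in>X. y a \<longrightarrow> e y \<in> U))))" (is "istopology ?P")
    unfolding istopology_def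
  proof (intro conjI allI impI)
    fix U V assume U: "?P U" and V: "?P V"
    show "U \<inter> V \<subseteq> e ` X"
      using U by blast
    show "\<forall>x\<in>X. e x \<in> U \<inter> V \<longrightarrow> (\<exists>a\<in>carrier A. x a \<and> (\<forall>y\<in>X. y a \<longrightarrow> e y \<in> U \<inter> V))"
    proof (intro ballI impI)
      fix x assume x: "x \<in> X" "e x \<in> U \<inter> V"
      then obtain a b where "a \<in> carrier A" "x a" "\<forall>y\<in>X. y a \<longrightarrow> e y \<in> U"
        "b \<in> carrier A" "x b" "\<forall>y\<in>X. y b \<longrightarrow> e y \<in> V"
        using U V by blast
      then show "\<exists>a\<in>carrier A. x a \<and> (\<forall>y\<in>X. y a \<longrightarrow> e y \<in> U \<inter> V)"
        using x by (intro bexI[of _ "a \<sqinter>\<^bsub>A\<^esub> b"]) (auto simp: z_algebra_point[OF zalg])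
    qed
  next
    fix \<U> assume \<U>: "\<forall>U\<in>\<U>. ?P U"
    then show "\<Union>\<U> \<subseteq> e ` X"
      by blast
    show "\<forall>x\<in>X. e x \<in> \<Union>\<U> \<longrightarrow> (\<exists>a\<in>carrier A. x a \<and> (\<forall>y\<in>X. y a \<longrightarrow> e y \<in> \<Union>\<U>))"
    proof (intro ballI impI)
      fix x assume x: "x \<in> X" "e x \<in> \<Union>\<U>"
      then obtain U where U: "U \<in> \<U>" "e x \<in> U"
        by blast
      then obtain a where "a \<in> carrier A" "x a" "\<forall>y\<in>X. y a \<longrightarrow> e y \<in> U"
        using \<U> x by meson
      then show "\<exists>a\<in>carrier A. x a \<and> (\<forall>y\<in>X. y a \<longrightarrow> e y \<in> \<Union>\<U>)"
        using U by blast
    qed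
  qed
  then show ?thesis
    by (simp add: stone_topology_def topology_inverse')
qed

lemma topspace_stone_topology: "topspace (stone_topology e (A, X)) = e ` X"
proof (rule antisym)
  have "openin (stone_topology e (A, X)) (e ` X)"
    unfolding openin_stone_topology using z_algebra_point(3)[OF zalg] by (auto intro!: bexI[of _ "\<top>\<^bsub>A\<^esub>"])
  then show "e ` X \<subseteq> topspace (stone_topology e (A, X))"
    by (rule openin_subset)
  show "topspace (stone_topology e (A, X)) \<subseteq> e ` X"
    unfolding topspace_def using openin_stone_topology by blast
qed

lemma stone_topology_basic_open:
  assumes "a \<in> carrier A"
  shows "openin (stone_topology e (A, X)) (e ` {x \<in> X. x a})"
  unfolding openin_stone_topology
proof (intro conjI ballI impI)
  fix x assume "x \<in> X" "e x \<in> e ` {x \<in> X. x a}"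
  then have "x a"
    using inj by (auto simp: inj_on_def)
  then show "\<exists>b\<in>carrier A. x b \<and> (\<forall>y\<in>X. y b \<longrightarrow> e y \<in> e ` {x \<in> X. x a})"
    using assms by blast
qed blast

text \<open>A complement in the algebra names the complementary basic set; injectivity of
  \<open>e\<close> lets images commute with set difference.\<close>

lemma stone_topology_basic_closed:
  assumes "a \<in> carrier A"
  shows "closedin (stone_topology e (A, X)) (e ` {x \<in> X. x a})"
proof -
  obtain b where b: "b \<in> carrier A" "\<And>x. x \<in> X \<Longrightarrow> x b \<longleftrightarrow> \<not> x a"
    using z_algebra_complement[OF zalg assms] by metis
  have "e ` X - e ` {x \<in> X. x a} = e ` (X - {x \<in> X. x a})"
    using inj by (intro inj_on_image_set_diff[symmetric]) auto
  also have "X - {x \<in> X. x a} = {x \<in> X. x b}"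
    using b by auto
  finally have "e ` X - e ` {x \<in> X. x a} = e ` {x \<in> X. x b}" .
  then show ?thesis
    using stone_topology_basic_open[OF b(1)] by (auto simp: closedin_def topspace_stone_topology)
qed

lemma stone_topology_base:
  assumes "openin (stone_topology e (A, X)) U" "x \<in> X" "e x \<in> U"
  obtains a where "a \<in> carrier A" "x a" "e ` {y \<in> X. y a} \<subseteq> U"
proof -
  obtain a where "a \<in> carrier A" "x a" "\<forall>y\<in>X. y a \<longrightarrow> e y \<in> U"
    using assms unfolding openin_stone_topology by meson
  then show ?thesis
    using that by (simp add: image_subset_iff)
qed

text \<open>A base of clopen sets makes the space zero-dimensional, hence completely regular. Points
  are extensional, so two distinct ones differ at some element of the carrier, and that element
  together with a complement separates them.\<close>

lemma tychonoff_stone_topology: "tychonoff_space (stone_topology e (A, X))"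
  unfolding tychonoff_space_def
proof (intro conjI)
  let ?T = "stone_topology e (A, X)"
  have base: "\<exists>U. (closedin ?T U \<and> openin ?T U) \<and> p \<in> U \<and> U \<subseteq> W"
    if W: "openin ?T W" "p \<in> W" for W p
  proof -
    obtain x where x: "x \<in> X" "p = e x"
      using W unfolding openin_stone_topology by blast
    then obtain a where "a \<in> carrier A" "x a" "e ` {y \<in> X. y a} \<subseteq> W"
      using W stone_topology_base by blast
    then show ?thesis
      using x by (intro exI[of _ "e ` {y \<in> X. y a}"])
        (auto simp: stone_topology_basic_open stone_topology_basic_closed)
  qed
  have "?T dim_le 0"
    unfolding dimension_le_0_neighbourhood_base_of_clopen
    by (subst open_neighbourhood_base_of; use base in auto)
  then show "completely_regular_space ?T"
    by (rule zero_dimensional_imp_completely_regular_space)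
  show "Hausdorff_space ?T"
    unfolding Hausdorff_space_def
  proof (intro allI impI)
    fix p q assume "p \<in> topspace ?T \<and> q \<in> topspace ?T \<and> p \<noteq> q"
    then obtain x y where xy: "x \<in> X" "y \<in> X" "p = e x" "q = e y" "x \<noteq> y"
      by (auto simp: topspace_stone_topology)
    then have "\<not> (\<forall>a\<in>carrier A. x a = y a)"
      using extensionalityI[OF z_algebra_point(1)[OF zalg xy(1)] z_algebra_point(1)[OF zalg xy(2)]]
      by blast
    then obtain a where a: "a \<in> carrier A" "x a \<noteq> y a"
      by blast
    obtain b where b: "b \<in> carrier A" "\<And>x. x \<in> X \<Longrightarrow> x b \<longleftrightarrow> \<not> x a"
      using z_algebra_complement[OF zalg a(1)] by metis
    \<comment> \<open>\<open>c\<close> and \<open>d\<close> are \<open>a\<close> and its complement,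
      ordered according to which of the two points is true at \<open>a\<close>.\<close>
    then obtain c d where cd: "c \<in> carrier A" "d \<in> carrier A" "x c" "y d"
      and disj: "\<And>z. z \<in> X \<Longrightarrow> z c \<longleftrightarrow> \<not> z d"
      using a xy(1,2) by (cases "x a") blast+
    have "disjnt (e ` {x \<in> X. x c}) (e ` {x \<in> X. x d})"
      using disj inj by (auto simp: disjnt_def inj_on_def)
    then show "\<exists>U V. openin ?T U \<and> openin ?T V \<and> p \<in> U \<and> q \<in> V \<and> disjnt U V"
      using stone_topology_basic_open[OF cd(1)] stone_topology_basic_open[OF cd(2)] xy cd
      by (intro exI[of _ "e ` {x \<in> X. x c}"] exI[of _ "e ` {x \<in> X. x d}"]) simp
  qed
qed

text \<open>The witness is the supremum of all elements whose basic set lies in \<open>U\<close>.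
  Its basic set is closed and contains \<open>U\<close>. Conversely, if some \<open>b\<close> had a
  basic set missing \<open>U\<close>, its complement would be an upper bound, so the supremum would
  lie below that complement and share no point with \<open>b\<close>.\<close>

lemma stone_topology_closure_of:
  assumes "complete_lattice A" and U: "openin (stone_topology e (A, X)) U"
  obtains a where "a \<in> carrier A" "stone_topology e (A, X) closure_of U = e ` {x \<in> X. x a}"
proof -
  interpret A: complete_lattice A by fact
  let ?T = "stone_topology e (A, X)"
  define B where "B = {b \<in> carrier A. e ` {x \<in> X. x b} \<subseteq> U}"
  have B: "B \<subseteq> carrier A"
    by (auto simp: B_def)
  obtain a where "least A a (Upper A B)"
    using A.sup_exists[OF B] by blast
  then have a: "a \<in> carrier A" "\<And>b. b \<in> B \<Longrightarrow> b \<sqsubseteq>\<^bsub>A\<^esub> a"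
    and least: "\<And>c. \<lbrakk>c \<in> carrier A; \<And>b. b \<in> B \<Longrightarrow> b \<sqsubseteq>\<^bsub>A\<^esub> c\<rbrakk> \<Longrightarrow> a \<sqsubseteq>\<^bsub>A\<^esub> c"
    using B by (auto simp: least_def Upper_def)
  have "U \<subseteq> e ` {x \<in> X. x a}"
  proof
    fix p assume p: "p \<in> U"
    then obtain x where x: "x \<in> X" "p = e x"
      using U openin_stone_topology by blast
    then obtain b where b: "b \<in> B" "x b"
      using stone_topology_base[OF U] p unfolding B_def by blast
    then have "x a"
      using a B x z_algebra_le_iff[OF zalg] by blast
    then show "p \<in> e ` {x \<in> X. x a}"
      using x by blast
  qed
  then have "?T closure_of U \<subseteq> e ` {x \<in> X. x a}"
    using stone_topology_basic_closed[OF a(1)] by (simp add: closure_of_minimal)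
  moreover have "e ` {x \<in> X. x a} \<subseteq> ?T closure_of U"
  proof
    fix p assume "p \<in> e ` {x \<in> X. x a}"
    then obtain x where x: "x \<in> X" "x a" "p = e x"
      by blast
    have "\<exists>q\<in>U. q \<in> V" if V: "p \<in> V" "openin ?T V" for V
    proof (rule ccontr)
      assume disj: "\<not> (\<exists>q\<in>U. q \<in> V)"
      obtain b where b: "b \<in> carrier A" "x b" "e ` {y \<in> X. y b} \<subseteq> V"
        using stone_topology_base[OF V(2)] x V by blast
      obtain c where c: "c \<in> carrier A" "\<And>x. x \<in> X \<Longrightarrow> x c \<longleftrightarrow> \<not> x b"
        using z_algebra_complement[OF zalg b(1)] by metis
      \<comment> \<open>A point true at both \<open>d\<close> and \<open>b\<close> would lie in
        \<open>U\<close> and in \<open>V\<close>, so every point true at \<open>d\<close> is true at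
        the complement \<open>c\<close> of \<open>b\<close>.\<close>
      have "d \<sqsubseteq>\<^bsub>A\<^esub> c" if "d \<in> B" for d
        using that B c(1) z_algebra_le_iff[OF zalg, of d c] disj b c unfolding B_def by blast
      then have "a \<sqsubseteq>\<^bsub>A\<^esub> c"
        using least c by blast
      then show False
        using z_algebra_le_iff[OF zalg a(1) c(1)] x b c by blast
    qed
    then show "p \<in> ?T closure_of U"
      using x by (auto simp: in_closure_of topspace_stone_topology)
  qed
  ultimately show ?thesis
    using that a by blast
qed

lemma extremally_disconnected_stone_topology:
  assumes "complete_lattice A"
  shows "extremally_disconnected_space (stone_topology e (A, X))"
  unfolding extremally_disconnected_space_def
proof (intro allI impI)
  fix U assume "openin (stone_topology e (A, X)) U"
  then obtain a where "a \<in> carrier A" "stone_topology e (A, X) closure_of U = e ` {x \<in> X. x a}"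
    using stone_topology_closure_of[OF assms] by blast
  then show "openin (stone_topology e (A, X)) (stone_topology e (A, X) closure_of U)"
    by (simp add: stone_topology_basic_open)
qed

lemma clopen_stone_topology:
  assumes "complete_lattice A" "openin (stone_topology e (A, X)) U" "closedin (stone_topology e (A, X)) U"
  obtains a where "a \<in> carrier A" "U = e ` {x \<in> X. x a}"
proof -
  obtain a where "a \<in> carrier A" "stone_topology e (A, X) closure_of U = e ` {x \<in> X. x a}"
    using stone_topology_closure_of[OF assms(1,2)] by blast
  then show ?thesis
    using that closure_of_closedin[OF assms(3)] by simp
qed

end


section \<open>The contravariant functor\<close>

lemma EDTych_simps:
  "Obj EDTych = {T. tychonoff_space T \<and> extremally_disconnected_space T}"
  "Hom EDTych S T = {f \<in> extensional (topspace S). continuous_map S T f}"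
  "Ide EDTych T = (\<lambda>t\<in>topspace T. t)"
  "Cmp EDTych R S T g f = compose (topspace R) g f"
  by (simp_all add: EDTych_def)

lemma category_EDTych: "category EDTych"
  unfolding category_def EDTych_simps
proof (intro conjI ballI)
  fix X Y Z :: "'a topology" and f g
  assume "f \<in> {f \<in> extensional (topspace X). continuous_map X Y f}"
    and "g \<in> {f \<in> extensional (topspace Y). continuous_map Y Z f}"
  then have "continuous_map X Z (g \<circ> f)"
    by (auto intro: continuous_map_compose)
  then have "continuous_map X Z (compose (topspace X) g f)"
    by (rule continuous_map_eq) (simp add: compose_def)
  then show "compose (topspace X) g f \<in> {f \<in> extensional (topspace X). continuous_map X Z f}"
    by simp
next
  fix X :: "'a topology"
  have "continuous_map X X (\<lambda>x\<in>topspace X. x)"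
    by (rule continuous_map_eq[OF continuous_map_id]) simp
  then show "(\<lambda>x\<in>topspace X. x) \<in> {f \<in> extensional (topspace X). continuous_map X X f}"
    by simp
qed (auto simp: compose_def fun_eq_iff extensional_def continuous_map_def Pi_iff)

lemma zBoole_simps:
  "Obj zBoole = {Z. z_algebra Z}"
  "(\<phi>, f) \<in> Hom zBoole (A, X) (A', X') \<longleftrightarrow> \<phi> \<in> boolean_hom A A' \<and> f \<in> X' \<rightarrow>\<^sub>E X \<and>
     (\<forall>x'\<in>X'. compose (carrier A) x' \<phi> = f x')"
  "Ide zBoole (A, X) = (\<lambda>a\<in>carrier A. a, \<lambda>x\<in>X. x)"
  "Cmp zBoole (A, X) (A', X') (A'', X'') (\<phi>', f') (\<phi>, f) =
     (compose (carrier A) \<phi>' \<phi>, compose X'' f f')"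
  by (simp_all add: zBoole_def)

text \<open>The lattice structure of \<open>A\<close> keeps bottom, top, joins and meets in the
  carrier, where \<open>compose\<close> is ordinary composition.\<close>

lemma boolean_hom_compose:
  assumes "\<phi> \<in> boolean_hom A B" "\<psi> \<in> boolean_hom B C" "bounded_lattice A"
  shows "compose (carrier A) \<psi> \<phi> \<in> boolean_hom A C"
proof -
  interpret bounded_lattice A by fact
  show ?thesis
    using assms by (auto simp: boolean_hom_def compose_eq PiE_def Pi_iff)
qed

lemma boolean_hom_Ide:
  assumes "bounded_lattice A"
  shows "(\<lambda>a\<in>carrier A. a) \<in> boolean_hom A A"
proof -
  interpret bounded_lattice A by fact
  show ?thesis
    by (auto simp: boolean_hom_def)
qed

lemma zBoole_HomD:
  assumes "(\<phi>, f) \<in> Hom zBoole (A, X) (A', X')"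
  shows "\<phi> \<in> boolean_hom A A'" "f \<in> X' \<rightarrow>\<^sub>E X" "\<phi> \<in> extensional (carrier A)" "f \<in> extensional X'"
    and "a \<in> carrier A \<Longrightarrow> \<phi> a \<in> carrier A'" "x' \<in> X' \<Longrightarrow> f x' \<in> X"
    and "\<lbrakk>a \<in> carrier A; x' \<in> X'\<rbrakk> \<Longrightarrow> f x' a = x' (\<phi> a)"
proof -
  show "\<phi> \<in> boolean_hom A A'" "f \<in> X' \<rightarrow>\<^sub>E X"
    and "\<lbrakk>a \<in> carrier A; x' \<in> X'\<rbrakk> \<Longrightarrow> f x' a = x' (\<phi> a)"
    using assms unfolding zBoole_simps by (auto simp: compose_eq dest!: bspec[of X' _ x'] fun_cong[of _ _ a])
  then show "\<phi> \<in> extensional (carrier A)" "f \<in> extensional X'"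
    and "a \<in> carrier A \<Longrightarrow> \<phi> a \<in> carrier A'" "x' \<in> X' \<Longrightarrow> f x' \<in> X"
    by (auto simp: boolean_hom_def PiE_def)
qed

text \<open>Since \<open>f x'\<close> is a point of \<open>(A, X)\<close>, it is extensional, so the
  required equality of functions reduces to values on the carrier.\<close>

lemma zBoole_HomI:
  assumes "z_algebra (A, X)" "\<phi> \<in> boolean_hom A A'" "f \<in> X' \<rightarrow>\<^sub>E X"
    and "\<And>x' a. \<lbrakk>x' \<in> X'; a \<in> carrier A\<rbrakk> \<Longrightarrow> f x' a = x' (\<phi> a)"
  shows "(\<phi>, f) \<in> Hom zBoole (A, X) (A', X')"
  unfolding zBoole_simps
proof (intro conjI ballI assms)
  fix x' assume x': "x' \<in> X'"
  then have "f x' \<in> X"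
    using assms(3) by auto
  then show "compose (carrier A) x' \<phi> = f x'"
    using x' assms(4) z_algebra_point(1)[OF assms(1)]
    by (intro extensionalityI[OF compose_extensional]) (auto simp: compose_eq)
qed

lemma category_zBoole: "category zBoole"
  unfolding category_def
proof (intro conjI ballI)
  fix Z :: "'a zalg" assume Z: "Z \<in> Obj zBoole"
  obtain A X where [simp]: "Z = (A, X)"
    by force
  show "Ide zBoole Z \<in> Hom zBoole Z Z"
    using Z by (auto simp: zBoole_simps(1,3) z_algebra_def boolean_lattice_def
        intro!: zBoole_HomI boolean_hom_Ide)
next
  fix Z Z' Z'' :: "'a zalg" and h h'
  assume Z: "Z \<in> Obj zBoole" "Z' \<in> Obj zBoole" "Z'' \<in> Obj zBoole"
    and h: "h \<in> Hom zBoole Z Z'" "h' \<in> Hom zBoole Z' Z''"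
  obtain A X A' X' A'' X'' \<phi> f \<phi>' f' where [simp]: "Z = (A, X)" "Z' = (A', X')" "Z'' = (A'', X'')"
    "h = (\<phi>, f)" "h' = (\<phi>', f')"
    by (metis surj_pair)
  note \<phi> = zBoole_HomD[OF h(1)[simplified]] and \<phi>' = zBoole_HomD[OF h(2)[simplified]]
  show "Cmp zBoole Z Z' Z'' h' h \<in> Hom zBoole Z Z''"
    unfolding \<open>Z = _\<close> \<open>Z' = _\<close> \<open>Z'' = _\<close> \<open>h = _\<close> \<open>h' = _\<close> zBoole_simps(4)
  proof (rule zBoole_HomI)
    show "compose (carrier A) \<phi>' \<phi> \<in> boolean_hom A A''"
      using Z \<phi>(1) \<phi>'(1) by (auto simp: zBoole_simps(1) z_algebra_def boolean_lattice_def
          intro: boolean_hom_compose)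
  qed (use Z in \<open>auto simp: zBoole_simps(1) compose_def \<phi>(5-) \<phi>'(5-)\<close>)
next
  fix Z Z' :: "'a zalg" and h
  assume Z: "Z \<in> Obj zBoole" "Z' \<in> Obj zBoole" and h: "h \<in> Hom zBoole Z Z'"
  obtain A X A' X' \<phi> f where [simp]: "Z = (A, X)" "Z' = (A', X')" "h = (\<phi>, f)"
    by (metis surj_pair)
  note \<phi> = zBoole_HomD[OF h[simplified]]
  show "Cmp zBoole Z Z Z' h (Ide zBoole Z) = h" "Cmp zBoole Z Z' Z' (Ide zBoole Z') h = h"
    using \<phi>(3-) by (auto simp: zBoole_simps compose_def fun_eq_iff extensional_def)
next
  fix Z0 Z1 Z2 Z3 :: "'a zalg" and h1 h2 h3
  assume h: "h1 \<in> Hom zBoole Z0 Z1" "h2 \<in> Hom zBoole Z1 Z2" "h3 \<in> Hom zBoole Z2 Z3"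
  obtain A0 X0 A1 X1 A2 X2 A3 X3 \<phi>1 f1 \<phi>2 f2 \<phi>3 f3 where
    [simp]: "Z0 = (A0, X0)" "Z1 = (A1, X1)" "Z2 = (A2, X2)" "Z3 = (A3, X3)"
      "h1 = (\<phi>1, f1)" "h2 = (\<phi>2, f2)" "h3 = (\<phi>3, f3)"
    by (metis surj_pair)
  show "Cmp zBoole Z0 Z2 Z3 h3 (Cmp zBoole Z0 Z1 Z2 h2 h1) =
      Cmp zBoole Z0 Z1 Z3 (Cmp zBoole Z1 Z2 Z3 h3 h2) h1"
    using zBoole_HomD(5-)[OF h(1)[simplified]] zBoole_HomD(5-)[OF h(3)[simplified]]
    by (auto simp: zBoole_simps compose_def fun_eq_iff)
qed

text \<open>The injection depends on the object, so an arrow acts by conjugation: decode a point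
  with \<open>e Z'\<close>, apply the map of points, encode with \<open>e Z\<close>.\<close>

definition stone_functor ::
  "('v zalg \<Rightarrow> ('v \<Rightarrow> bool) \<Rightarrow> 'u) \<Rightarrow>
    ('v zalg, ('v \<Rightarrow> 'v) \<times> (('v \<Rightarrow> bool) \<Rightarrow> ('v \<Rightarrow> bool)), 'u topology, 'u \<Rightarrow> 'u) fctr" where
  "stone_functor e = \<lparr>omap = (\<lambda>Z. stone_topology (e Z) Z),
     amap = (\<lambda>Z Z' h. \<lambda>p\<in>e Z' ` snd Z'. e Z (snd h (inv_into (snd Z') (e Z') p)))\<rparr>"

lemma stone_functor_simps:
  "omap (stone_functor e) Z = stone_topology (e Z) Z"
  "inj_on (e (A', X')) X' \<Longrightarrow> x' \<in> X' \<Longrightarrow>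
    amap (stone_functor e) Z (A', X') (\<phi>, f) (e (A', X') x') = e Z (f x')"
  "amap (stone_functor e) Z (A', X') h \<in> extensional (e (A', X') ` X')"
  by (simp_all add: stone_functor_def)

text \<open>The equation \<open>f x' a = x' (\<phi> a)\<close> says that the preimage of the basic
  set of \<open>a\<close> is the basic set of \<open>\<phi> a\<close>.\<close>

lemma continuous_stone_functor:
  assumes "z_algebra (A, X)" "z_algebra (A', X')"
    and inj: "inj_on (e (A, X)) X" "inj_on (e (A', X')) X'"
    and h: "(\<phi>, f) \<in> Hom zBoole (A, X) (A', X')"
  shows "continuous_map (stone_topology (e (A', X')) (A', X')) (stone_topology (e (A, X)) (A, X))
    (amap (stone_functor e) (A, X) (A', X') (\<phi>, f))"
    (is "continuous_map ?S ?T ?g")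
  unfolding continuous_map_def
proof (intro conjI allI impI)
  note hD = zBoole_HomD[OF h] and g = stone_functor_simps(2)[of e, OF inj(2)]
  have S: "topspace ?S = e (A', X') ` X'" and T: "topspace ?T = e (A, X) ` X"
    using assms by (simp_all add: topspace_stone_topology)
  show "?g \<in> topspace ?S \<rightarrow> topspace ?T"
    unfolding S T by (auto simp: g hD)
  fix U assume U: "openin ?T U"
  show "openin ?S {x \<in> topspace ?S. ?g x \<in> U}"
    unfolding openin_stone_topology[OF assms(2) inj(2)] S
  proof (intro conjI ballI impI)
    fix x' assume x': "x' \<in> X'" "e (A', X') x' \<in> {x \<in> e (A', X') ` X'. ?g x \<in> U}"
    then have "f x' \<in> X" "e (A, X) (f x') \<in> U"
      by (simp_all add: g hD)
    then obtain a where a: "a \<in> carrier A" "f x' a" "e (A, X) ` {y \<in> X. y a} \<subseteq> U"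
      using stone_topology_base[OF assms(1) inj(1) U] by blast
    have "\<forall>y'\<in>X'. y' (\<phi> a) \<longrightarrow> e (A', X') y' \<in> {x \<in> e (A', X') ` X'. ?g x \<in> U}"
    proof (intro ballI impI)
      fix y' assume y': "y' \<in> X'" "y' (\<phi> a)"
      then have "e (A, X) (f y') \<in> U"
        using a hD by auto
      then show "e (A', X') y' \<in> {x \<in> e (A', X') ` X'. ?g x \<in> U}"
        using y' by (simp add: g)
    qed
    then show "\<exists>a'\<in>carrier A'. x' a' \<and>
        (\<forall>y'\<in>X'. y' a' \<longrightarrow> e (A', X') y' \<in> {x \<in> e (A', X') ` X'. ?g x \<in> U})"
      using a x' hD(5,7) by (intro bexI[of _ "\<phi> a"]) simp_all
  qed blast
qed

text \<open>Conjugating \<open>g\<close> back gives the map \<open>f\<close> on points. The preimage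
  of the basic set of \<open>a\<close> is clopen, hence basic by completeness of \<open>A'\<close>,
  and an element naming it serves as \<open>\<phi> a\<close>. For uniqueness, \<open>g\<close>
  determines \<open>f\<close> because \<open>e (A, X)\<close> is injective, and \<open>f\<close>
  determines \<open>\<phi>\<close> because points distinguish the elements of
  \<open>A'\<close>.\<close>

lemma stone_functor_full_faithful:
  assumes Z: "z_algebra (A, X)" and Z': "z_algebra (A', X')" "complete_lattice A'"
    and inj: "inj_on (e (A, X)) X" and inj': "inj_on (e (A', X')) X'"
    and g: "continuous_map (stone_topology (e (A', X')) (A', X')) (stone_topology (e (A, X)) (A, X)) g"
      "g \<in> extensional (e (A', X') ` X')"
  shows "\<exists>!h. h \<in> Hom zBoole (A, X) (A', X') \<and> amap (stone_functor e) (A, X) (A', X') h = g"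
proof (rule ex_ex1I)
  let ?S = "stone_topology (e (A', X')) (A', X')" and ?T = "stone_topology (e (A, X)) (A, X)"
  note amap = stone_functor_simps(2)[of e, OF inj']
  have S: "topspace ?S = e (A', X') ` X'" and T: "topspace ?T = e (A, X) ` X"
    using assms by (simp_all add: topspace_stone_topology)
  define f where "f = (\<lambda>x'\<in>X'. inv_into X (e (A, X)) (g (e (A', X') x')))"
  have gX: "g (e (A', X') x') \<in> e (A, X) ` X" if "x' \<in> X'" for x'
    using g(1) that unfolding continuous_map_def S T by blast
  have f: "f x' \<in> X" "e (A, X) (f x') = g (e (A', X') x')" if "x' \<in> X'" for x'
    using gX[OF that] that by (simp_all add: f_def inv_into_into f_inv_into_f)
  have "\<exists>a'\<in>carrier A'. \<forall>x'\<in>X'. x' a' \<longleftrightarrow> f x' a" if a: "a \<in> carrier A" for a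
  proof -
    let ?U = "{p \<in> topspace ?S. g p \<in> e (A, X) ` {x \<in> X. x a}}"
    have "openin ?S ?U" "closedin ?S ?U"
      using g(1) stone_topology_basic_open[OF Z inj a] stone_topology_basic_closed[OF Z inj a]
      by (auto intro: openin_continuous_map_preimage closedin_continuous_map_preimage)
    then obtain a' where a': "a' \<in> carrier A'" "?U = e (A', X') ` {x' \<in> X'. x' a'}"
      using clopen_stone_topology[OF Z'(1) inj' Z'(2)] by blast
    have "x' a' \<longleftrightarrow> f x' a" if x': "x' \<in> X'" for x'
    proof -
      have "x' a' \<longleftrightarrow> e (A', X') x' \<in> ?U"
        unfolding a'(2) using inj_on_image_mem_iff[OF inj' x', of "{x' \<in> X'. x' a'}"] x' by simp
      also have "\<dots> \<longleftrightarrow> e (A, X) (f x') \<in> e (A, X) ` {x \<in> X. x a}"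
        using x' f by (simp add: S)
      also have "\<dots> \<longleftrightarrow> f x' a"
        using inj_on_image_mem_iff[OF inj f(1)[OF x'], of "{x \<in> X. x a}"] f(1)[OF x'] by simp
      finally show ?thesis .
    qed
    then show ?thesis
      using a' by blast
  qed
  then obtain \<phi>0 where \<phi>0: "\<And>a. a \<in> carrier A \<Longrightarrow> \<phi>0 a \<in> carrier A'"
    "\<And>a x'. \<lbrakk>a \<in> carrier A; x' \<in> X'\<rbrakk> \<Longrightarrow> x' (\<phi>0 a) \<longleftrightarrow> f x' a"
    by metis
  \<comment> \<open>The choice function is arbitrary off the carrier, whereas an arrow has to be
    extensional.\<close>
  define \<phi> where "\<phi> = restrict \<phi>0 (carrier A)"
  have \<phi>: "\<phi> a \<in> carrier A'" "x' \<in> X' \<Longrightarrow> x' (\<phi> a) \<longleftrightarrow> f x' a" if "a \<in> carrier A" for a x'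
    using that \<phi>0 by (simp_all add: \<phi>_def)
  interpret A: bounded_lattice A
    using Z by (simp add: z_algebra_def boolean_lattice_def)
  interpret A': bounded_lattice A'
    using Z' by (simp add: z_algebra_def boolean_lattice_def)
  have "\<phi> \<in> carrier A \<rightarrow>\<^sub>E carrier A'"
    by (auto simp: \<phi>_def \<phi>0)
  \<comment> \<open>Each homomorphism law is an equation in \<open>A'\<close>, tested at a point
    \<open>x'\<close>. There \<open>x' (\<phi> a)\<close> becomes \<open>f x' a\<close>, and
    \<open>f x'\<close> obeys the law because it is itself a point of \<open>(A, X)\<close>.\<close>
  then have "\<phi> \<in> boolean_hom A A'"
    unfolding boolean_hom_def
    by (auto simp: \<phi> f z_algebra_point[OF Z] z_algebra_point[OF Z'(1)]
        intro!: z_algebra_eqI[OF Z'(1)] simp del: PiE_iff)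
  then have "(\<phi>, f) \<in> Hom zBoole (A, X) (A', X')"
    by (intro zBoole_HomI[OF Z]) (auto simp: \<phi> f, simp add: f_def)
  moreover have "amap (stone_functor e) (A, X) (A', X') (\<phi>, f) = g"
    by (rule extensionalityI[of _ "e (A', X') ` X'"]) (auto simp: stone_functor_simps(3) g(2) amap f)
  ultimately show "\<exists>h. h \<in> Hom zBoole (A, X) (A', X') \<and> amap (stone_functor e) (A, X) (A', X') h = g"
    by blast
next
  note amap = stone_functor_simps(2)[of e, OF inj']
  fix h1 h2
  assume h: "h1 \<in> Hom zBoole (A, X) (A', X') \<and> amap (stone_functor e) (A, X) (A', X') h1 = g"
    "h2 \<in> Hom zBoole (A, X) (A', X') \<and> amap (stone_functor e) (A, X) (A', X') h2 = g"
  obtain \<phi>1 f1 \<phi>2 f2 where [simp]: "h1 = (\<phi>1, f1)" "h2 = (\<phi>2, f2)"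
    by (metis surj_pair)
  note 1 = zBoole_HomD[of \<phi>1 f1 A X A' X'] and 2 = zBoole_HomD[of \<phi>2 f2 A X A' X']
  have "e (A, X) (f1 x') = e (A, X) (f2 x')" if "x' \<in> X'" for x'
    using h amap[OF that] by (metis \<open>h1 = _\<close> \<open>h2 = _\<close>)
  then have eq: "f1 x' = f2 x'" if "x' \<in> X'" for x'
    using that inj h 1(6) 2(6) by (simp add: inj_on_def)
  then have "f1 = f2"
    using h 1(4) 2(4) by (intro extensionalityI[of f1 X' f2]) auto
  moreover have "\<phi>1 a = \<phi>2 a" if "a \<in> carrier A" for a
    using h that 1 2 eq by (intro z_algebra_eqI[OF Z'(1)]) (auto 0 0, metis+)
  then have "\<phi>1 = \<phi>2"
    using h 1(3) 2(3) by (intro extensionalityI[of \<phi>1 "carrier A" \<phi>2]) auto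
  ultimately show "h1 = h2"
    by simp
qed


section \<open>The clopen algebra of a space\<close>

definition clopens :: "'u topology \<Rightarrow> 'u set set" where
  "clopens T = {U. openin T U \<and> closedin T U}"

text \<open>The clopen sets are moved along an injection \<open>i\<close> into the type of elements of the target algebras.\<close>

definition clopen_algebra :: "('u set \<Rightarrow> 'v) \<Rightarrow> 'u topology \<Rightarrow> 'v gorder" where
  "clopen_algebra i T = \<lparr>carrier = i ` clopens T, eq = (=),
     le = (\<lambda>a b. inv_into (clopens T) i a \<subseteq> inv_into (clopens T) i b)\<rparr>"

text \<open>Evaluation at \<open>t\<close>, that is, the ultrafilter of clopen sets containing
  \<open>t\<close>; the restriction to the carrier makes it extensional.\<close>

definition clopen_point :: "('u set \<Rightarrow> 'v) \<Rightarrow> 'u topology \<Rightarrow> 'u \<Rightarrow> 'v \<Rightarrow> bool" where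
  "clopen_point i T t = (\<lambda>a\<in>i ` clopens T. t \<in> inv_into (clopens T) i a)"

text \<open>Only evaluations are taken as points. All homomorphisms into \<open>two\<close> would
  give the compact Stone space of the clopen algebra instead of \<open>T\<close>.\<close>

definition clopen_zalg :: "('u set \<Rightarrow> 'v) \<Rightarrow> 'u topology \<Rightarrow> 'v zalg" where
  "clopen_zalg i T = (clopen_algebra i T, clopen_point i T ` topspace T)"

lemma clopens_intros [simp]:
  "{} \<in> clopens T" "topspace T \<in> clopens T"
  "U \<in> clopens T \<Longrightarrow> V \<in> clopens T \<Longrightarrow> U \<union> V \<in> clopens T"
  "U \<in> clopens T \<Longrightarrow> V \<in> clopens T \<Longrightarrow> U \<inter> V \<in> clopens T"
  "U \<in> clopens T \<Longrightarrow> topspace T - U \<in> clopens T"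
  by (auto simp: clopens_def)

lemma clopens_subset: "U \<in> clopens T \<Longrightarrow> U \<subseteq> topspace T"
  by (simp add: clopens_def openin_subset)

text \<open>The dual form of extremal disconnectedness, obtained by passing to complements. It
  supplies the infima of families of clopen sets.\<close>

lemma interior_of_closed_clopen:
  assumes "extremally_disconnected_space T" "closedin T S"
  shows "T interior_of S \<in> clopens T"
proof -
  have "openin T (T closure_of (topspace T - S))"
    using assms by (simp add: extremally_disconnected_space_def openin_diff)
  then show ?thesis
    unfolding interior_of_closure_of clopens_def by (simp add: openin_diff closedin_diff)
qed

lemma tychonoff_extremally_disconnected_clopen_base:
  assumes "tychonoff_space T" "extremally_disconnected_space T" "openin T W" "t \<in> W"
  obtains U where "U \<in> clopens T" "t \<in> U" "U \<subseteq> W"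
proof -
  have "regular_space T"
    using assms by (simp add: tychonoff_space_def completely_regular_imp_regular_space)
  moreover have "closedin T (topspace T - W)" "t \<in> topspace T - (topspace T - W)"
    using assms openin_subset by auto
  ultimately obtain U where U: "openin T U" "t \<in> U" "disjnt (topspace T - W) (T closure_of U)"
    unfolding regular_space by blast
  have "openin T (T closure_of U)"
    using assms U by (simp add: extremally_disconnected_space_def)
  moreover have "t \<in> T closure_of U"
    using U closure_of_subset[OF openin_subset] by blast
  moreover have "T closure_of U \<subseteq> W"
    using U closure_of_subset_topspace[of T U] by (auto simp: disjnt_def)
  ultimately show ?thesis
    using that[of "T closure_of U"] by (simp add: clopens_def)
qed

section \<open>The clopen algebra is a complete z-algebra whose space is the given one\<close>

context
  fixes i :: "'u set \<Rightarrow> 'v" and T :: "'u topology"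
  assumes inj: "inj_on i (clopens T)" and ed: "extremally_disconnected_space T"
begin

private abbreviation (input) "K \<equiv> clopens T"
private abbreviation (input) "B \<equiv> clopen_algebra i T"

lemma clopen_algebra_simps [simp]:
  "carrier B = i ` K" "a .=\<^bsub>B\<^esub> b \<longleftrightarrow> a = b"
  "\<lbrakk>U \<in> K; V \<in> K\<rbrakk> \<Longrightarrow> i U \<sqsubseteq>\<^bsub>B\<^esub> i V \<longleftrightarrow> U \<subseteq> V"
  by (simp_all add: clopen_algebra_def inj)

lemma clopen_point_simps [simp]:
  "U \<in> K \<Longrightarrow> clopen_point i T t (i U) \<longleftrightarrow> t \<in> U"
  by (simp add: clopen_point_def inj)

text \<open>A greatest element and infima of nonempty families suffice. An intersection of clopen
  sets is closed but perhaps not open, so the infimum is its interior.\<close>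

lemma complete_lattice_clopen_algebra: "complete_lattice B"
proof -
  interpret partial_order B
    by unfold_locales (auto simp: fun_eq_iff)
  show ?thesis
  proof (rule complete_lattice_criterion1)
    show "\<exists>g. greatest B g (carrier B)"
      by (intro exI[of _ "i (topspace T)"]) (auto simp: greatest_def clopens_subset)
  next
    fix S assume S: "S \<subseteq> carrier B" "S \<noteq> {}"
    define \<U> where "\<U> = {U \<in> K. i U \<in> S}"
    have SU: "S = i ` \<U>" and \<U>: "\<U> \<subseteq> K"
      using S by (auto simp: \<U>_def)
    define M where "M = T interior_of \<Inter>\<U>"
    \<comment> \<open>Nonemptiness of \<open>S\<close> matters: the intersection of the empty family
      is \<open>UNIV\<close>, which need not be closed in \<open>T\<close>.\<close>
    have M: "M \<in> K"
      unfolding M_def using S SU \<U>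
      by (intro interior_of_closed_clopen[OF ed] closedin_Inter) (auto simp: clopens_def)
    have "greatest B (i M) (Lower B S)"
    proof (rule greatest_LowerI)
      fix a assume "a \<in> S"
      then obtain U where "U \<in> \<U>" "a = i U"
        using SU by blast
      moreover have "M \<subseteq> U" if "U \<in> \<U>" for U
        using that interior_of_subset[of T "\<Inter>\<U>"] unfolding M_def by blast
      ultimately show "i M \<sqsubseteq>\<^bsub>B\<^esub> a"
        using M \<U> by auto
    next
      fix a assume a: "a \<in> Lower B S"
      then obtain V where V: "V \<in> K" "a = i V"
        unfolding Lower_def by auto
      have "V \<subseteq> U" if "U \<in> \<U>" for U
      proof -
        have "i V \<sqsubseteq>\<^bsub>B\<^esub> i U"
          using a V that SU S unfolding Lower_def by blast
        then show ?thesis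
          using V \<U> that clopen_algebra_simps(3)[of V U] by blast
      qed
      then have "V \<subseteq> M"
        unfolding M_def using V by (intro interior_of_maximal) (auto simp: clopens_def)
      then show "a \<sqsubseteq>\<^bsub>B\<^esub> i M"
        using V M by simp
    qed (use S M in auto)
    then show "\<exists>m. greatest B m (Lower B S)"
      by blast
  qed
qed

interpretation complete_lattice B
  by (rule complete_lattice_clopen_algebra)

interpretation bounded_lattice B
  by unfold_locales

text \<open>Abstractly, a join is only known to be \<open>i J\<close> for some clopen
  \<open>J\<close>; its universal property, tested against the clopen union, forces \<open>J\<close>
  to be that union. Meets are dual.\<close>

lemma clopen_algebra_ops:
  shows "\<bottom>\<^bsub>B\<^esub> = i {}" "\<top>\<^bsub>B\<^esub> = i (topspace T)"
    and "\<lbrakk>U \<in> K; V \<in> K\<rbrakk> \<Longrightarrow> i U \<squnion>\<^bsub>B\<^esub> i V = i (U \<union> V)"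
    and "\<lbrakk>U \<in> K; V \<in> K\<rbrakk> \<Longrightarrow> i U \<sqinter>\<^bsub>B\<^esub> i V = i (U \<inter> V)"
proof -
  show "\<bottom>\<^bsub>B\<^esub> = i {}"
    by (rule bottom_eq[symmetric]) auto
  show "\<top>\<^bsub>B\<^esub> = i (topspace T)"
    by (rule top_eq[symmetric]) (auto simp: clopens_subset)
  assume U: "U \<in> K" and V: "V \<in> K"
  \<comment> \<open>The carrier stays folded, so that the closure rules of the lattice for joins and
    meets can match.\<close>
  have "i U \<squnion>\<^bsub>B\<^esub> i V \<in> carrier B" "i U \<sqinter>\<^bsub>B\<^esub> i V \<in> carrier B"
    using U V by (simp_all del: clopen_algebra_simps(1) add: imageI[of _ K i, folded clopen_algebra_simps(1)])
  then obtain J M where J: "J \<in> K" "i U \<squnion>\<^bsub>B\<^esub> i V = i J" and M: "M \<in> K" "i U \<sqinter>\<^bsub>B\<^esub> i V = i M"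
    by auto
  have "U \<subseteq> J" "V \<subseteq> J"
    using join_left[of "i U" "i V"] join_right[of "i U" "i V"] U V J by simp_all
  moreover have "J \<subseteq> U \<union> V"
    using join_le[of "i U" "i (U \<union> V)" "i V"] U V J by simp
  ultimately show "i U \<squnion>\<^bsub>B\<^esub> i V = i (U \<union> V)"
    using J(2) by (metis Un_least subset_antisym)
  have "M \<subseteq> U" "M \<subseteq> V"
    using meet_left[of "i U" "i V"] meet_right[of "i U" "i V"] U V M by simp_all
  moreover have "U \<inter> V \<subseteq> M"
    using meet_le[of "i (U \<inter> V)" "i U" "i V"] U V M by simp
  ultimately show "i U \<sqinter>\<^bsub>B\<^esub> i V = i (U \<inter> V)"
    using M(2) by (metis Int_greatest subset_antisym)
qed

lemma boolean_lattice_clopen_algebra: "boolean_lattice B"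
  unfolding boolean_lattice_def
proof (intro conjI ballI)
  show "bounded_lattice B"
    by unfold_locales
next
  fix a b c assume "a \<in> carrier B" "b \<in> carrier B" "c \<in> carrier B"
  then show "a \<sqinter>\<^bsub>B\<^esub> (b \<squnion>\<^bsub>B\<^esub> c) = (a \<sqinter>\<^bsub>B\<^esub> b) \<squnion>\<^bsub>B\<^esub> (a \<sqinter>\<^bsub>B\<^esub> c)"
    by (auto simp: clopen_algebra_ops Int_Un_distrib)
next
  fix a assume "a \<in> carrier B"
  then obtain U where U: "U \<in> K" "a = i U"
    by auto
  then have "U \<union> (topspace T - U) = topspace T" "U \<inter> (topspace T - U) = {}"
    using clopens_subset by auto
  then show "\<exists>b\<in>carrier B. a \<squnion>\<^bsub>B\<^esub> b = \<top>\<^bsub>B\<^esub> \<and> a \<sqinter>\<^bsub>B\<^esub> b = \<bottom>\<^bsub>B\<^esub>"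
    using U by (intro bexI[of _ "i (topspace T - U)"]) (simp_all add: clopen_algebra_ops)
qed

lemma z_algebra_clopen_zalg: "z_algebra (clopen_zalg i T)"
  unfolding z_algebra_def clopen_zalg_def prod.case
proof (intro conjI ballI boolean_lattice_clopen_algebra subsetI)
  fix x assume "x \<in> clopen_point i T ` topspace T"
  then obtain t where "t \<in> topspace T" "x = clopen_point i T t"
    by blast
  moreover have "clopen_point i T t \<in> extensional (carrier B)"
    by (simp add: clopen_point_def)
  ultimately show "x \<in> boolean_hom B two"
    by (auto simp: boolean_hom_def two_simps clopen_algebra_ops PiE_def) (simp_all add: two_def)
next
  fix a assume "a \<in> carrier B - {\<bottom>\<^bsub>B\<^esub>}"
  then obtain U where U: "U \<in> K" "a = i U" "U \<noteq> {}"
    by (auto simp: clopen_algebra_ops)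
  then obtain t where "t \<in> U" "t \<in> topspace T"
    using clopens_subset by blast
  then show "\<exists>x\<in>clopen_point i T ` topspace T. x a = \<top>\<^bsub>two\<^esub>"
    using U by (auto simp: two_simps)
qed

text \<open>The evaluation at \<open>t\<close> is true at \<open>i U\<close> iff \<open>t\<close>
  lies in \<open>U\<close>, so clopen sets of \<open>T\<close> correspond to basic sets. Both
  topologies are generated by them, which gives continuity and openness.\<close>

lemma homeomorphic_stone_clopen_zalg:
  assumes ty: "tychonoff_space T" and e: "inj_on e (clopen_point i T ` topspace T)"
  shows "homeomorphic_map T (stone_topology e (clopen_zalg i T)) (e \<circ> clopen_point i T)"
proof (rule bijective_open_imp_homeomorphic_map)
  let ?S = "stone_topology e (clopen_zalg i T)" and ?X = "clopen_point i T ` topspace T"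
  have zalg: "z_algebra (clopen_algebra i T, ?X)"
    using z_algebra_clopen_zalg by (simp add: clopen_zalg_def)
  have S: "topspace ?S = e ` ?X"
    using topspace_stone_topology[OF zalg e] by (simp add: clopen_zalg_def)
  show "(e \<circ> clopen_point i T) ` topspace T = topspace ?S"
    by (simp add: S image_comp)
  \<comment> \<open>Restates openness with clopen sets and points of \<open>T\<close>, removing the
    encoding \<open>i\<close> from all that follows.\<close>
  have open_iff: "openin ?S W \<longleftrightarrow> W \<subseteq> e ` ?X \<and> (\<forall>t\<in>topspace T. e (clopen_point i T t) \<in> W \<longrightarrow>
      (\<exists>U\<in>K. t \<in> U \<and> (\<forall>s\<in>topspace T. s \<in> U \<longrightarrow> e (clopen_point i T s) \<in> W)))" for W
    by (simp add: clopen_zalg_def openin_stone_topology[OF zalg e] cong: bex_cong_simp)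
  \<comment> \<open>A clopen set inside a Hausdorff neighbourhood of \<open>s\<close> that omits
    \<open>t\<close> distinguishes the two evaluations.\<close>
  have inj_point: "inj_on (clopen_point i T) (topspace T)"
  proof (rule inj_onI)
    fix s t assume st: "s \<in> topspace T" "t \<in> topspace T" "clopen_point i T s = clopen_point i T t"
    show "s = t"
    proof (rule ccontr)
      assume "s \<noteq> t"
      then obtain V where V: "openin T V" "s \<in> V" "t \<notin> V"
        using ty st by (metis Hausdorff_space_def disjnt_iff tychonoff_space_def)
      obtain U where U: "U \<in> K" "s \<in> U" "U \<subseteq> V"
        using tychonoff_extremally_disconnected_clopen_base[OF ty ed V(1,2)] by blast
      then have "t \<in> U"
        using clopen_point_simps[OF U(1), of s] clopen_point_simps[OF U(1), of t] st(3) by simp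
      then show False
        using V U by blast
    qed
  qed
  show "inj_on (e \<circ> clopen_point i T) (topspace T)"
    using inj_point e by (rule comp_inj_on)
  show "continuous_map T ?S (e \<circ> clopen_point i T)"
    unfolding continuous_map_def
  proof (intro conjI allI impI)
    show "e \<circ> clopen_point i T \<in> topspace T \<rightarrow> topspace ?S"
      by (simp add: S)
    fix W assume W: "openin ?S W"
    show "openin T {t \<in> topspace T. (e \<circ> clopen_point i T) t \<in> W}"
    proof (subst openin_subopen, intro ballI)
      fix t assume "t \<in> {t \<in> topspace T. (e \<circ> clopen_point i T) t \<in> W}"
      then obtain U where "U \<in> K" "t \<in> U" "\<forall>s\<in>topspace T. s \<in> U \<longrightarrow> e (clopen_point i T s) \<in> W"
        using W unfolding open_iff by auto
      then show "\<exists>U. openin T U \<and> t \<in> U \<and> U \<subseteq> {t \<in> topspace T. (e \<circ> clopen_point i T) t \<in> W}"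
        using clopens_subset[of U T] by (intro exI[of _ U]) (auto simp: clopens_def)
    qed
  qed
  show "open_map T ?S (e \<circ> clopen_point i T)"
    unfolding open_map_def
  proof (intro allI impI)
    fix W assume W: "openin T W"
    then have WT: "W \<subseteq> topspace T"
      by (rule openin_subset)
    have mem: "(e \<circ> clopen_point i T) t \<in> (e \<circ> clopen_point i T) ` W \<longleftrightarrow> t \<in> W" if "t \<in> topspace T" for t
      using inj_on_image_mem_iff[OF comp_inj_on[OF inj_point e] that WT] .
    show "openin ?S ((e \<circ> clopen_point i T) ` W)"
      unfolding open_iff
    proof (intro conjI ballI impI)
      show "(e \<circ> clopen_point i T) ` W \<subseteq> e ` ?X"
        using WT by auto
      fix t assume t: "t \<in> topspace T" "e (clopen_point i T t) \<in> (e \<circ> clopen_point i T) ` W"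
      then have "t \<in> W"
        using mem by simp
      then obtain U where U: "U \<in> K" "t \<in> U" "U \<subseteq> W"
        using tychonoff_extremally_disconnected_clopen_base[OF ty ed W] by blast
      then show "\<exists>U\<in>K. t \<in> U \<and> (\<forall>s\<in>topspace T. s \<in> U \<longrightarrow> e (clopen_point i T s) \<in> (e \<circ> clopen_point i T) ` W)"
        by (intro bexI[of _ U]) auto
    qed
  qed
qed

end

text \<open>A homeomorphism and its inverse are constrained only on the spaces; their restrictions
  are extensional and compose to the identity arrows.\<close>

lemma homeomorphic_map_iso_arrow:
  assumes "homeomorphic_map S T h"
  shows "\<exists>u. iso_arrow EDTych S T u"
proof -
  obtain k where h: "continuous_map S T h" and k: "continuous_map T S k"
    and kh: "\<And>x. x \<in> topspace S \<Longrightarrow> k (h x) = x" and hk: "\<And>y. y \<in> topspace T \<Longrightarrow> h (k y) = y"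
    using assms by (auto simp: homeomorphic_map_maps homeomorphic_maps_def)
  let ?u = "restrict h (topspace S)" and ?v = "restrict k (topspace T)"
  have "continuous_map S T ?u" "continuous_map T S ?v"
    using h k by (auto intro: continuous_map_eq)
  moreover have "compose (topspace S) ?v ?u = (\<lambda>x\<in>topspace S. x)"
    "compose (topspace T) ?u ?v = (\<lambda>y\<in>topspace T. y)"
    using h k kh hk by (auto simp: compose_def fun_eq_iff continuous_map_def)
  ultimately have "iso_arrow EDTych S T ?u"
    by (auto simp: iso_arrow_def EDTych_def intro!: bexI[of _ ?v])
  then show ?thesis
    by blast
qed


section \<open>The dual equivalence\<close>

lemma zCBoole_simps:
  "Hom zCBoole = Hom zBoole" "Ide zCBoole = Ide zBoole" "Cmp zCBoole = Cmp zBoole"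
  by (simp_all add: zCBoole_def)

text \<open>Covers both readings of size at once, with \<open>P\<close> and \<open>Q\<close> as the
  size conditions. The bounds granted in the hypotheses are those the constructions provide: clopen
  sets of the space of \<open>A\<close> are indexed by elements of \<open>A\<close>, and points of
  the clopen algebra by points of \<open>T\<close>.\<close>

lemma dually_equivalent_EDTych_zCBoole:
  fixes P :: "'u topology set" and Q :: "'v zalg set"
  assumes encode_points: "\<And>A X. \<lbrakk>z_algebra (A, X); complete_lattice A; (A, X) \<in> Q\<rbrakk> \<Longrightarrow>
      \<exists>e. inj_on e X \<and> (\<forall>T. topspace T = e ` X \<longrightarrow> clopens T \<lesssim> carrier A \<longrightarrow> T \<in> P)"
    and encode_clopens: "\<And>T. T \<in> P \<Longrightarrow>
      \<exists>i. inj_on i (clopens T) \<and> (\<forall>A X. carrier A = i ` clopens T \<longrightarrow> X \<lesssim> topspace T \<longrightarrow> (A, X) \<in> Q)"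
  shows "dually_equivalent (full_subcategory EDTych P) (full_subcategory zCBoole Q)"
proof -
  let ?C = "full_subcategory EDTych P" and ?D = "full_subcategory zCBoole Q"
  have D_Obj: "(A, X) \<in> Obj ?D \<longleftrightarrow> z_algebra (A, X) \<and> complete_lattice A \<and> (A, X) \<in> Q" for A X
    by (auto simp: zCBoole_def zBoole_simps(1))
  then have zalg: "\<And>A X. (A, X) \<in> Obj ?D \<Longrightarrow> z_algebra (A, X)"
    and compl: "\<And>A X. (A, X) \<in> Obj ?D \<Longrightarrow> complete_lattice A"
    by blast+
  have "\<forall>Z\<in>Obj ?D. \<exists>e. inj_on e (snd Z) \<and>
      (\<forall>T. topspace T = e ` snd Z \<longrightarrow> clopens T \<lesssim> carrier (fst Z) \<longrightarrow> T \<in> P)"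
  proof
    fix Z assume "Z \<in> Obj ?D"
    then show "\<exists>e. inj_on e (snd Z) \<and>
        (\<forall>T. topspace T = e ` snd Z \<longrightarrow> clopens T \<lesssim> carrier (fst Z) \<longrightarrow> T \<in> P)"
      using encode_points[of "fst Z" "snd Z"] D_Obj[of "fst Z" "snd Z"] by simp
  qed
  from bchoice[OF this] obtain e where
    e: "\<And>Z. Z \<in> Obj ?D \<Longrightarrow> inj_on (e Z) (snd Z) \<and>
      (\<forall>T. topspace T = e Z ` snd Z \<longrightarrow> clopens T \<lesssim> carrier (fst Z) \<longrightarrow> T \<in> P)"
    by blast
  have inj: "inj_on (e (A, X)) X" if "(A, X) \<in> Obj ?D" for A X
    using e[OF that] by simp
  have G_Obj: "stone_topology (e (A, X)) (A, X) \<in> Obj ?C" if Z: "(A, X) \<in> Obj ?D" for A X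
  proof -
    let ?T = "stone_topology (e (A, X)) (A, X)"
    \<comment> \<open>Completeness enters the size bound as well: every clopen set is basic, so
      there are at most as many as elements of \<open>A\<close>.\<close>
    have "clopens ?T \<subseteq> (\<lambda>a. e (A, X) ` {x \<in> X. x a}) ` carrier A"
    proof
      fix U assume "U \<in> clopens ?T"
      then obtain a where "a \<in> carrier A" "U = e (A, X) ` {x \<in> X. x a}"
        using clopen_stone_topology[OF zalg[OF Z] inj[OF Z] compl[OF Z]] unfolding clopens_def by blast
      then show "U \<in> (\<lambda>a. e (A, X) ` {x \<in> X. x a}) ` carrier A"
        by blast
    qed
    then have "clopens ?T \<lesssim> carrier A"
      using lepoll_trans[OF subset_imp_lepoll image_lepoll] by blast
    then have "?T \<in> P"
      using e[OF Z] topspace_stone_topology[OF zalg[OF Z] inj[OF Z]] by simp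
    then show ?thesis
      using tychonoff_stone_topology[OF zalg[OF Z] inj[OF Z]]
        extremally_disconnected_stone_topology[OF zalg[OF Z] inj[OF Z] compl[OF Z]]
      by (simp add: EDTych_simps)
  qed
  show ?thesis
  proof (rule dually_equivalentI)
    show "category ?C"
      by (intro category_full_subcategory category_EDTych)
    show "category ?D"
      unfolding zCBoole_def by (intro category_full_subcategory category_zBoole)
    show "contravariant_functor ?D ?C (stone_functor e)"
      unfolding contravariant_functor_def
    proof (intro conjI ballI)
      fix Z assume "Z \<in> Obj ?D"
      then show "omap (stone_functor e) Z \<in> Obj ?C"
        using G_Obj by (cases Z) (simp add: stone_functor_simps(1))
    next
      fix Z Z' h assume Z: "Z \<in> Obj ?D" "Z' \<in> Obj ?D" and h: "h \<in> Hom ?D Z Z'"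
      obtain A X A' X' \<phi> f where [simp]: "Z = (A, X)" "Z' = (A', X')" "h = (\<phi>, f)"
        by (metis surj_pair)
      show "amap (stone_functor e) Z Z' h \<in> Hom ?C (omap (stone_functor e) Z') (omap (stone_functor e) Z)"
        using Z h inj[of A X] inj[of A' X'] zalg[of A X] zalg[of A' X']
        by (simp add: EDTych_simps stone_functor_simps zCBoole_simps continuous_stone_functor
            topspace_stone_topology)
    next
      fix Z assume Z: "Z \<in> Obj ?D"
      obtain A X where [simp]: "Z = (A, X)"
        by (metis surj_pair)
      show "amap (stone_functor e) Z Z (Ide ?D Z) = Ide ?C (omap (stone_functor e) Z)"
        using Z inj[of A X] zalg[of A X]
        by (auto intro!: extensionalityI[of _ "e Z ` X"] simp: zCBoole_simps EDTych_simps
            zBoole_simps stone_functor_simps topspace_stone_topology)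
    next
      fix Z Z' Z'' h h'
      assume Z: "Z \<in> Obj ?D" "Z' \<in> Obj ?D" "Z'' \<in> Obj ?D"
        and h: "h \<in> Hom ?D Z Z'" "h' \<in> Hom ?D Z' Z''"
      obtain A X A' X' A'' X'' \<phi> f \<phi>' f' where [simp]: "Z = (A, X)" "Z' = (A', X')" "Z'' = (A'', X'')"
        "h = (\<phi>, f)" "h' = (\<phi>', f')"
        by (metis surj_pair)
      have f': "f' x \<in> X'" if "x \<in> X''" for x
        using h(2) that by (auto simp: zCBoole_simps dest: zBoole_HomD(6))
      have S: "topspace (stone_topology (e Z'') Z'') = e Z'' ` X''"
        using Z(3) inj[of A'' X''] zalg[of A'' X''] by (simp add: topspace_stone_topology)
      show "amap (stone_functor e) Z Z'' (Cmp ?D Z Z' Z'' h' h) =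
          Cmp ?C (omap (stone_functor e) Z'') (omap (stone_functor e) Z') (omap (stone_functor e) Z)
            (amap (stone_functor e) Z Z' h) (amap (stone_functor e) Z' Z'' h')"
      \<comment> \<open>At an encoded point \<open>e Z'' x\<close> both sides evaluate to
        \<open>e Z (f (f' x))\<close>.\<close>
      proof (rule extensionalityI[of _ "e Z'' ` X''"])
        fix p assume "p \<in> e Z'' ` X''"
        then obtain x where x: "x \<in> X''" "p = e Z'' x"
          by blast
        then show "amap (stone_functor e) Z Z'' (Cmp ?D Z Z' Z'' h' h) p =
          Cmp ?C (omap (stone_functor e) Z'') (omap (stone_functor e) Z') (omap (stone_functor e) Z)
            (amap (stone_functor e) Z Z' h) (amap (stone_functor e) Z' Z'' h') p"
          using Z inj[of A' X'] inj[of A'' X''] f' S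
          by (simp add: zCBoole_simps EDTych_simps zBoole_simps stone_functor_simps compose_eq)
      qed (use S in \<open>simp_all add: EDTych_simps stone_functor_simps\<close>)
    qed
  next
    fix Z Z' g assume Z: "Z \<in> Obj ?D" "Z' \<in> Obj ?D"
      and g: "g \<in> Hom ?C (omap (stone_functor e) Z') (omap (stone_functor e) Z)"
    obtain A X A' X' where [simp]: "Z = (A, X)" "Z' = (A', X')"
      by (metis surj_pair)
    show "\<exists>!h. h \<in> Hom ?D Z Z' \<and> amap (stone_functor e) Z Z' h = g"
      using Z g inj[of A X] inj[of A' X'] zalg[of A X] zalg[of A' X'] compl[of A' X']
      by (simp add: zCBoole_simps EDTych_simps stone_functor_simps topspace_stone_topology
          stone_functor_full_faithful)
  next
    fix T assume "T \<in> Obj ?C"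
    then have T: "tychonoff_space T" "extremally_disconnected_space T" "T \<in> P"
      by (simp_all add: EDTych_simps)
    obtain i where i: "inj_on i (clopens T)"
      and Q: "\<And>A X. \<lbrakk>carrier A = i ` clopens T; X \<lesssim> topspace T\<rbrakk> \<Longrightarrow> (A, X) \<in> Q"
      using encode_clopens[OF T(3)] by blast
    have "clopen_zalg i T \<in> Q"
      unfolding clopen_zalg_def by (rule Q) (simp_all add: clopen_algebra_def image_lepoll)
    then have Z: "clopen_zalg i T \<in> Obj ?D"
      using z_algebra_clopen_zalg[OF i T(2)] complete_lattice_clopen_algebra[OF i T(2)]
      unfolding clopen_zalg_def D_Obj by simp
    then have "inj_on (e (clopen_zalg i T)) (clopen_point i T ` topspace T)"
      using inj by (simp add: clopen_zalg_def)
    from homeomorphic_map_iso_arrow[OF homeomorphic_stone_clopen_zalg[OF i T(2,1) this]]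
    show "\<exists>Z\<in>Obj ?D. \<exists>u. iso_arrow ?C T (omap (stone_functor e) Z) u"
      using Z by (auto simp: iso_arrow_def stone_functor_simps intro!: bexI[of _ "clopen_zalg i T"])
  qed
qed

section \<open>Size bounds and the two instances\<close>

lemma z_algebra_points_lepoll:
  assumes "z_algebra (A, X)"
  shows "X \<lesssim> Pow (carrier A)"
proof -
  \<comment> \<open>An extensional predicate is determined by the elements of the carrier at which
    it is true.\<close>
  have "inj_on (\<lambda>x. {a \<in> carrier A. x a}) X"
  proof (rule inj_onI)
    fix x y assume "x \<in> X" "y \<in> X" "{a \<in> carrier A. x a} = {a \<in> carrier A. y a}"
    then show "x = y"
      using z_algebra_point(1)[OF assms] by (intro extensionalityI[of x "carrier A" y]) auto
  qed
  then show ?thesis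
    unfolding lepoll_def by (intro exI[of _ "\<lambda>x. {a \<in> carrier A. x a}"]) auto
qed

text \<open>A member of \<open>U\<close> dominates the power set, and closure under smaller sets
  puts the encoded copy into \<open>U\<close>. It serves both directions: points embed into sets of
  elements, and clopen sets are sets of points.\<close>

lemma universe_encode:
  assumes "universe U" "A \<in> U" "S \<lesssim> Pow A"
  obtains f where "inj_on f S" "f ` S \<in> U"
proof -
  obtain B where B: "B \<in> U" "Pow A \<lesssim> B"
    using assms unfolding universe_def by blast
  then have "S \<lesssim> B"
    using assms lepoll_trans by blast
  then obtain f where f: "inj_on f S" "f ` S \<subseteq> B"
    unfolding lepoll_def by auto
  then have "f ` S \<in> U"
    using assms(1) B(1) subset_imp_lepoll unfolding universe_def by blast
  then show ?thesis
    using that f by blast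
qed

theorem theorem7p2:
  shows "(\<forall>U :: 'w set set. universe U \<longrightarrow>
            dually_equivalent (EDTych_small U) (zCBoole_small U)) \<and>
         dually_equivalent
            (EDTych_bounded TYPE('v) :: ('u topology, 'u \<Rightarrow> 'u) cat)
            (zCBoole_bounded TYPE('u) ::
               ('v zalg, ('v \<Rightarrow> 'v) \<times> (('v \<Rightarrow> bool) \<Rightarrow> ('v \<Rightarrow> bool))) cat)"
proof (intro conjI allI impI)
  fix U :: "'w set set" assume U: "universe U"
  show "dually_equivalent (EDTych_small U) (zCBoole_small U)"
    unfolding EDTych_small_def zCBoole_small_def
  proof (rule dually_equivalent_EDTych_zCBoole)
    fix A :: "'w gorder" and X
    assume "z_algebra (A, X)" "(A, X) \<in> {(A, X). carrier A \<in> U}"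
    then obtain e where "inj_on e X" "e ` X \<in> U"
      using universe_encode[OF U _ z_algebra_points_lepoll] by auto
    then show "\<exists>e. inj_on e X \<and>
        (\<forall>T. topspace T = e ` X \<longrightarrow> clopens T \<lesssim> carrier A \<longrightarrow> T \<in> {T. topspace T \<in> U})"
      by auto
  next
    fix T :: "'w topology" assume "T \<in> {T. topspace T \<in> U}"
    moreover have "clopens T \<lesssim> Pow (topspace T)"
      using clopens_subset by (intro subset_imp_lepoll) blast
    ultimately obtain i where "inj_on i (clopens T)" "i ` clopens T \<in> U"
      using universe_encode[OF U] by blast
    then show "\<exists>i. inj_on i (clopens T) \<and> (\<forall>A X. carrier A = i ` clopens T \<longrightarrow>
        X \<lesssim> topspace T \<longrightarrow> (A, X) \<in> {(A, X). carrier A \<in> U})"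
      by auto
  qed
next
  show "dually_equivalent (EDTych_bounded TYPE('v) :: ('u topology, 'u \<Rightarrow> 'u) cat)
     (zCBoole_bounded TYPE('u) :: ('v zalg, ('v \<Rightarrow> 'v) \<times> (('v \<Rightarrow> bool) \<Rightarrow> ('v \<Rightarrow> bool))) cat)"
    unfolding EDTych_bounded_def zCBoole_bounded_def
  proof (rule dually_equivalent_EDTych_zCBoole)
    fix A :: "'v gorder" and X :: "('v \<Rightarrow> bool) set"
    assume "(A, X) \<in> {(A, X). X \<lesssim> (UNIV :: 'u set)}"
    then obtain e :: "('v \<Rightarrow> bool) \<Rightarrow> 'u" where e: "inj_on e X"
      by (auto simp: lepoll_def)
    \<comment> \<open>The carrier of \<open>A\<close> is a subset of \<open>'v\<close>, so any bound
      by it is a bound by the whole type.\<close>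
    have "T \<in> {T. {S. openin T S \<and> closedin T S} \<lesssim> (UNIV :: 'v set)}"
      if "clopens T \<lesssim> carrier A" for T :: "'u topology"
      using lepoll_trans[OF that subset_imp_lepoll[OF subset_UNIV]] by (simp add: clopens_def)
    then show "\<exists>e :: ('v \<Rightarrow> bool) \<Rightarrow> 'u. inj_on e X \<and>
      (\<forall>T. topspace T = e ` X \<longrightarrow> clopens T \<lesssim> carrier A \<longrightarrow>
        T \<in> {T. {S. openin T S \<and> closedin T S} \<lesssim> (UNIV :: 'v set)})"
      using e by blast
  next
    fix T :: "'u topology" assume "T \<in> {T. {S. openin T S \<and> closedin T S} \<lesssim> (UNIV :: 'v set)}"
    then obtain i :: "'u set \<Rightarrow> 'v" where i: "inj_on i (clopens T)"
      by (auto simp: lepoll_def clopens_def)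
    have "(A, X) \<in> {(A, X). X \<lesssim> (UNIV :: 'u set)}"
      if "X \<lesssim> topspace T" for A :: "'v gorder" and X :: "('v \<Rightarrow> bool) set"
      using lepoll_trans[OF that subset_imp_lepoll[OF subset_UNIV]] by simp
    then show "\<exists>i. inj_on i (clopens T) \<and> (\<forall>A X. carrier A = i ` clopens T \<longrightarrow>
        X \<lesssim> topspace T \<longrightarrow> (A, X) \<in> {(A :: 'v gorder, X :: ('v \<Rightarrow> bool) set). X \<lesssim> (UNIV :: 'u set)})"
      using i by blast
  qed
qed

end
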